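(* Let $n\geq 2$ be an integer and let $\{D_n(t):t\geq 0\}$ be the radial component of the $n$-dimensional hyperbolic Brownian motion started at the origin $O_n$ of $\mathbb{H}^n$. Then, for every $\beta\in(0,1/2)$, as $t\to\infty$, the family of real random variables $$\left\{t^{(2\beta-1)/2}\left(\frac{D_n(t)-(n-1)t}{\sqrt{t}}\right):t>0\right\}$$ satisfies the large deviation principle on $\mathbb{R}$ with speed $v_t=t^{1-2\beta}$ and rate function $I_2$ defined by $I_2(x)=\frac{x^2}{4}$ for all $x\in\mathbb{R}$.
   Context: Hyperbolic space: for an integer $n\geq 2$, $\mathbb{H}^n=\{z=(x,y):x\in\mathbb{R}^{n-1},\,y>0\}$ with origin $O_n=(0,\ldots,0,1)$ and Riemannian metric $ds^2=\frac{dx_1^2+\cdots+dx_{n-1}^2+dy^2}{y^2}$. The hyperbolic distance $\eta(z,z')$ between $z=(x,y)$ and $z'=(x',y')$ is given by $\cosh\eta(z,z')=\frac{|x-x'|^2+y^2+y'^2}{2yy'}$, where $|\cdot|$ is the Euclidean norm on $\mathbb{R}^{n-1}$. The volume element is $dv=y^{-n}\,dx\,dy=\sinh^{n-1}\eta\,d\eta\,d\Omega_n$, where $d\Omega_n$ is the surface element of the unit sphere in $\mathbb{R}^n$. The Laplace-Beltrami operator is $\Delta_n=y^2\left(\sum_{i=1}^{n-1}\frac{\partial^2}{\partial x_i^2}+\frac{\partial^2}{\partial y^2}\right)-(n-2)\,y\frac{\partial}{\partial y}$. Heat kernel: $k_n(z,z',t)$ is the heat kernel, with respect to $dv$, of the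 equation $\partial_t u=\Delta_n u$. It depends on $z,z'$ only through $\eta=\eta(z,z')$ and is written $k_n(\eta,t)$; for instance $k_3(\eta,t)=\frac{e^{-t}}{2^3(\pi t)^{3/2}}\frac{\eta e^{-\eta^2/(4t)}}{\sinh\eta}$. Radial component: the hyperbolic Brownian motion is the diffusion on $\mathbb{H}^n$ with transition density $k_n$ with respect to $dv$, started at $O_n$, and $D_n(t)$ is the hyperbolic distance from $O_n$ to its position at time $t$. Thus $D_n(0)=0$ and, for $t>0$, $D_n(t)$ has density $p_n(\eta,t)=\frac{2\pi^{n/2}}{\Gamma(n/2)}k_n(\eta,t)\sinh^{n-1}\eta$ on $\eta>0$ with respect to Lebesgue measure. Large deviation principle: a rate function on $\mathbb{R}$ is a lower semicontinuous function $I:\mathbb{R}\to[0,\infty]$. A family $\{X(t):t>0\}$ of real random variables satisfies the large deviation principle, as $t\to\infty$, with rate function $I$ and speed $v_t$ if $\lim_{t\to\infty}v_t=\infty$, $\limsup_{t\to\infty}\frac{1}{v_t}\log P(X(t)\in F)\leq-\inf_{x\in F}I(x)$ for all closed sets $F\subset\mathbb{R}$, and $\liminf_{t\to\infty}\frac{1}{v_t}\log P(X(t)\in G)\geq-\inf_{x\in G}I(x)$ for all open sets $G\subset\mathbb{R}$ (with $\log 0=-\infty$ and $\inf\emptyset=\infty$). *)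

theory Defs
  imports "HOL-Probability.Probability"
begin

section \<open>Hyperbolic space\<close>

text \<open>
  The half-space model of hyperbolic \<open>n\<close>-space, with points \<open>(x, y)\<close>, \<open>x \<in> \<real>\<^sup>n\<^sup>-\<^sup>1\<close>, \<open>y > 0\<close>.
  The index type \<open>'m\<close> has \<open>n - 1\<close> elements, so \<open>n = CARD('m) + 1\<close> throughout; index types
  are nonempty, so every \<open>n \<ge> 2\<close> and no other value occurs.
\<close>

type_synonym 'm hpoint = "(real ^ 'm) \<times> real"

definition hspace :: "('m::finite) hpoint set" where
  "hspace = {z. snd z > 0}"

definition horigin :: "('m::finite) hpoint" where
  "horigin = (0, 1)"

definition hdist :: "('m::finite) hpoint \<Rightarrow> 'm hpoint \<Rightarrow> real" where
  "hdist z z' = arcosh (((norm (fst z - fst z'))\<^sup>2 + (snd z)\<^sup>2 + (snd z')\<^sup>2) / (2 * snd z * snd z'))"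

text \<open>
  The volume element \<open>y\<^sup>-\<^sup>n dx dy\<close>, as a measure on the ambient Euclidean space that does not
  charge the complement of the half-space.
\<close>

definition hvol :: "('m::finite) hpoint measure" where
  "hvol = density lborel (\<lambda>z. indicator hspace z * ennreal (1 / snd z ^ (CARD('m) + 1)))"

definition partial :: "'a::real_normed_vector \<Rightarrow> ('a \<Rightarrow> real) \<Rightarrow> 'a \<Rightarrow> real" where
  "partial b f z = deriv (\<lambda>h. f (z + h *\<^sub>R b)) 0"

text \<open>The Laplace--Beltrami operator; the first-order coefficient is \<open>n - 2 = CARD('m) - 1\<close>.\<close>

definition hlaplace :: "(('m::finite) hpoint \<Rightarrow> real) \<Rightarrow> 'm hpoint \<Rightarrow> real" where
  "hlaplace f z =
     (snd z)\<^sup>2 * ((\<Sum>i\<in>UNIV. partial (axis i 1, 0) (partial (axis i 1, 0) f) z)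
                 + partial (0, 1) (partial (0, 1) f) z)
     - (real CARD('m) - 1) * snd z * partial (0, 1) f z"

section \<open>The heat kernel\<close>

text \<open>
  \<open>u\<close> is \<open>C\<^sup>2\<close> in the space variable on \<open>S\<close> and \<open>C\<^sup>1\<close> in the time variable on \<open>(0, \<infinity>)\<close>, with all
  these derivatives jointly continuous.
\<close>

definition C21_on :: "'a::euclidean_space set \<Rightarrow> ('a \<Rightarrow> real \<Rightarrow> real) \<Rightarrow> bool" where
  "C21_on S u \<longleftrightarrow>
     continuous_on (S \<times> {0<..}) (\<lambda>(z, t). u z t) \<and>
     (\<forall>z\<in>S. \<forall>t>0. u z differentiable (at t)) \<and>
     continuous_on (S \<times> {0<..}) (\<lambda>(z, t). deriv (u z) t) \<and>
     (\<forall>b\<in>Basis.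
        (\<forall>z\<in>S. \<forall>t>0. (\<lambda>h. u (z + h *\<^sub>R b) t) differentiable (at 0)) \<and>
        continuous_on (S \<times> {0<..}) (\<lambda>(z, t). partial b (\<lambda>z. u z t) z)) \<and>
     (\<forall>b\<in>Basis. \<forall>c\<in>Basis.
        (\<forall>z\<in>S. \<forall>t>0. (\<lambda>h. partial b (\<lambda>z. u z t) (z + h *\<^sub>R c)) differentiable (at 0)) \<and>
        continuous_on (S \<times> {0<..}) (\<lambda>(z, t). partial c (partial b (\<lambda>z. u z t)) z))"

text \<open>
  Nonnegative fundamental solutions of \<open>\<partial>\<^sub>t u = \<Delta>\<^sub>n u\<close> with respect to \<open>hvol\<close>: for every source
  \<open>w\<close>, \<open>K(\<cdot>, w, t)\<close> is a nonnegative classical solution that converges weakly to the unit mass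
  at \<open>w\<close> as \<open>t \<down> 0\<close>.  Nonnegative solutions on hyperbolic space are determined by their
  initial data, so this singles out the heat kernel without a minimality clause.
\<close>

definition heat_kernel :: "(('m::finite) hpoint \<Rightarrow> 'm hpoint \<Rightarrow> real \<Rightarrow> real) \<Rightarrow> bool" where
  "heat_kernel K \<longleftrightarrow>
     (\<forall>w\<in>hspace.
        (\<forall>z\<in>hspace. \<forall>t>0. K z w t \<ge> 0) \<and>
        C21_on hspace (\<lambda>z t. K z w t) \<and>
        (\<forall>z\<in>hspace. \<forall>t>0. deriv (\<lambda>s. K z w s) t = hlaplace (\<lambda>z. K z w t) z) \<and>
        (\<forall>f. continuous_on hspace f \<and> bounded (f ` hspace) \<longrightarrow>
           ((\<lambda>t. LINT z:hspace|hvol. K z w t * f z) \<longlongrightarrow> f w) (at_right 0)))"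

section \<open>Hyperbolic Brownian motion\<close>

definition past :: "'w measure \<Rightarrow> (real \<Rightarrow> 'w \<Rightarrow> 'b::topological_space) \<Rightarrow> real \<Rightarrow> 'w measure" where
  "past M B s = sigma (space M) {B r -` A \<inter> space M | r A. 0 \<le> r \<and> r \<le> s \<and> A \<in> sets borel}"

text \<open>
  The diffusion started at the origin whose transition density with respect to \<open>hvol\<close> is \<open>K\<close>:
  a continuous process in \<open>hspace\<close> that is Markov for its natural filtration, with
  \<open>P(B\<^sub>t \<in> A | past up to s) = \<integral>\<^sub>A K(B\<^sub>s, z, t - s) dv(z)\<close>.
\<close>

definition hyperbolic_bm ::
  "'w measure \<Rightarrow> (('m::finite) hpoint \<Rightarrow> 'm hpoint \<Rightarrow> real \<Rightarrow> real) \<Rightarrow> (real \<Rightarrow> 'w \<Rightarrow> 'm hpoint) \<Rightarrow> bool"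
where
  "hyperbolic_bm M K B \<longleftrightarrow>
     prob_space M \<and>
     (\<forall>t\<ge>0. B t \<in> borel_measurable M) \<and>
     (\<forall>t\<ge>0. \<forall>\<omega>\<in>space M. B t \<omega> \<in> hspace) \<and>
     (AE \<omega> in M. B 0 \<omega> = horigin) \<and>
     (AE \<omega> in M. continuous_on {0..} (\<lambda>t. B t \<omega>)) \<and>
     (\<forall>s t A. 0 \<le> s \<and> s < t \<and> A \<in> sets borel \<longrightarrow>
        (AE \<omega> in M. real_cond_exp M (past M B s) (indicator (B t -` A \<inter> space M)) \<omega>
                     = (LINT z:A|hvol. K (B s \<omega>) z (t - s))))"

definition radial_component :: "(real \<Rightarrow> 'w \<Rightarrow> ('m::finite) hpoint) \<Rightarrow> real \<Rightarrow> 'w \<Rightarrow> real" where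
  "radial_component B t \<omega> = hdist horigin (B t \<omega>)"

section \<open>Large deviation principles\<close>

definition rate_function :: "(real \<Rightarrow> ereal) \<Rightarrow> bool" where
  "rate_function I \<longleftrightarrow> (\<forall>x. 0 \<le> I x) \<and> (\<forall>x. I x \<le> Liminf (at x) I)"

definition log_prob :: "real \<Rightarrow> ereal" where
  "log_prob p = (if p = 0 then - \<infinity> else ereal (ln p))"

text \<open>In \<^typ>\<open>ereal\<close>, the infimum over the empty set is \<open>\<infinity>\<close>.\<close>

definition large_deviation_principle ::
  "'w measure \<Rightarrow> (real \<Rightarrow> 'w \<Rightarrow> real) \<Rightarrow> (real \<Rightarrow> real) \<Rightarrow> (real \<Rightarrow> ereal) \<Rightarrow> bool"
where
  "large_deviation_principle M X v I \<longleftrightarrow>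
     (\<forall>t>0. X t \<in> borel_measurable M) \<and>
     rate_function I \<and>
     filterlim v at_top at_top \<and>
     (\<forall>F. closed F \<longrightarrow>
        Limsup at_top (\<lambda>t. ereal (1 / v t) * log_prob (measure M {\<omega>\<in>space M. X t \<omega> \<in> F}))
          \<le> - (INF x\<in>F. I x)) \<and>
     (\<forall>G. open G \<longrightarrow>
        Liminf at_top (\<lambda>t. ereal (1 / v t) * log_prob (measure M {\<omega>\<in>space M. X t \<omega> \<in> G}))
          \<ge> - (INF x\<in>G. I x))"

end

theory Submission
  imports Defs "HOL-Real_Asymp.Real_Asymp"
begin

text \<open>
  The proof never computes the heat kernel.  It finds the exponential moments of the distance
  \<open>D\<^sub>n(t)\<close> up to constants, by comparison with explicit powers of
  \<open>q = cosh D\<^sub>n(t) = (|x|\<^sup>2 + y\<^sup>2 + 1) / (2 y)\<close>, and then runs the argument of Gaertner and Ellis.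

  A function \<open>g(q)\<close> of the distance satisfies \<open>\<Delta>\<^sub>n g(q) = (q\<^sup>2 - 1) g''(q) + n q g'(q)\<close>, so that
  \<open>q\<^sup>s\<close> is almost an eigenfunction: \<open>\<Delta>\<^sub>n q\<^sup>s = s (s + n - 1) q\<^sup>s - s (s - 1) q\<^sup>s\<^sup>-\<^sup>2\<close>.  Lower order
  corrections turn \<open>q\<^sup>s\<close> into genuine sub- and supersolutions, and one gets
  \<open>E (exp (s D\<^sub>n(t))) = exp (s (s + n - 1) t)\<close> up to a factor between \<open>1/4\<close> and \<open>4\<close>, for all \<open>t > 0\<close>
  and all \<open>s\<close> near \<open>0\<close> (\<open>distance_mgf\<close>).  With \<open>s = \<theta> t\<^sup>-\<^sup>\<beta>\<close> the linear part \<open>s (n - 1) t\<close> is the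
  centring, and \<open>s\<^sup>2 t = \<theta>\<^sup>2 t\<^sup>1\<^sup>-\<^sup>2\<^sup>\<beta>\<close> remains: on the exponential scale \<open>v\<^sub>t\<close> the logarithmic
  moment generating function is \<open>\<theta>\<^sup>2\<close>, whose Legendre transform is \<open>x\<^sup>2 / 4\<close>
  (\<open>gaussian_mgf_imp_large_deviation_principle\<close>).

  The difficulty is that nothing is known in advance about the decay of the kernel \<open>k\<close> at
  infinity; the one global fact at hand is that the process has total mass one.  For compactly
  supported \<open>g\<close>, Green's identity and the heat equation give
  \<open>d/dt E (g(q\<^sub>t)) = E (\<Delta>\<^sub>n g(q\<^sub>t))\<close> (\<open>radial_test_function_evolution\<close>).  A cutoff in the variable
  \<open>ln q / R\<close>, that is on the scale \<open>R\<close> of the hyperbolic distance, costs an error of order \<open>1/R\<close>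
  relative to a bound on the test function, which is enough to pass to bounded test functions
  and then to those dominated by something with a known moment (\<open>comparison\<close>).  A bounded
  increasing concave function of a supersolution provides the first such moment
  (\<open>positive_moment_upper\<close>).
\<close>

section \<open>Green's identity on the half-space\<close>

text \<open>
  The integral of \<open>z \<mapsto> G (z + h b)\<close> does not depend on \<open>h\<close>; its derivative at \<open>h = 0\<close> is the integral
  of the directional derivative of \<open>G\<close>.
\<close>

lemma integral_directional_derivative_eq_0:
  fixes G G' :: "'a::euclidean_space \<Rightarrow> real"
  assumes b: "b \<in> Basis"
    and der: "\<And>z. ((\<lambda>h. G (z + h *\<^sub>R b)) has_real_derivative G' z) (at 0)"
    and G: "continuous_on UNIV G" and G': "continuous_on UNIV G'"
    and supp: "\<And>z. z \<notin> cbox a c \<Longrightarrow> G z = 0 \<and> G' z = 0"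
  shows "integral (cbox a c) G' = 0"
proof -
  \<comment> \<open>On the enlarged box the translates by at most one unit are still supported inside.\<close>
  define a' where "a' = a - One"
  define c' where "c' = c + One"
  have sub: "cbox a c \<subseteq> cbox (a' + h *\<^sub>R b) (c' + h *\<^sub>R b)" if "h \<in> {-1..1}" for h
  proof -
    have "a' \<bullet> i + h * (b \<bullet> i) \<le> a \<bullet> i \<and> c \<bullet> i \<le> c' \<bullet> i + h * (b \<bullet> i)" if "i \<in> Basis" for i
    proof -
      have "\<bar>h * (b \<bullet> i)\<bar> \<le> 1 * 1"
        unfolding abs_mult using \<open>h \<in> {-1..1}\<close> b that
        by (intro mult_mono) (auto simp: inner_Basis)
      then show ?thesis
        using that by (auto simp: a'_def c'_def inner_diff_left inner_add_left)
    qed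
    then show ?thesis
      by (force simp: mem_box inner_add_left)
  qed
  have shift: "integral (cbox a' c') (\<lambda>z. G (z + h *\<^sub>R b)) = integral (cbox a c) G"
    if "h \<in> {-1..1}" for h
  proof -
    have "integral (cbox a' c') (\<lambda>z. G (z + h *\<^sub>R b)) = integral (cbox (a' + h *\<^sub>R b) (c' + h *\<^sub>R b)) G"
      using integral_shift_cbox_plus[of a' c' G "h *\<^sub>R b"] by (simp add: o_def add.commute)
    also have "\<dots> = integral (cbox a c) G"
      by (rule integral_spike_set)
        (use sub[OF that] supp in \<open>auto intro!: negligible_subset[OF negligible_empty]\<close>)
    finally show ?thesis .
  qed
  have "((\<lambda>h. integral (cbox a' c') (\<lambda>z. G (z + h *\<^sub>R b))) has_field_derivative
      integral (cbox a' c') (\<lambda>z. G' (z + 0 *\<^sub>R b))) (at 0 within {-1..1})"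
  proof (rule leibniz_rule_field_derivative)
    fix h z
    have "((\<lambda>k. G ((z + h *\<^sub>R b) + k *\<^sub>R b)) has_real_derivative G' (z + h *\<^sub>R b)) (at 0)"
      by (rule der)
    then have "((\<lambda>k. G (z + k *\<^sub>R b)) has_real_derivative G' (z + h *\<^sub>R b)) (at (0 + h))"
      by (subst DERIV_shift) (simp add: algebra_simps)
    then show "((\<lambda>h. G (z + h *\<^sub>R b)) has_field_derivative G' (z + h *\<^sub>R b)) (at h within {-1..1})"
      by (auto intro: has_field_derivative_at_within)
  next
    fix h :: real
    show "(\<lambda>z. G (z + h *\<^sub>R b)) integrable_on cbox a' c'"
      by (intro integrable_continuous continuous_on_compose2[OF G] continuous_intros) auto
  next
    show "continuous_on ({-1..1} \<times> cbox a' c') (\<lambda>(h, z). G' (z + h *\<^sub>R b))"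
      unfolding split_beta
      by (intro continuous_on_compose2[OF G'] continuous_intros) auto
  qed auto
  moreover have "at 0 within {-1..1} = at (0::real)"
    by (rule at_within_Icc_at) auto
  ultimately have "((\<lambda>h. integral (cbox a' c') (\<lambda>z. G (z + h *\<^sub>R b))) has_field_derivative
      integral (cbox a' c') G') (at 0)"
    by simp
  then have "((\<lambda>h. integral (cbox a c) G) has_field_derivative integral (cbox a' c') G') (at 0)"
    by (rule has_field_derivative_transform_within_open[where S = "{-1<..<1}"]) (auto intro!: shift)
  then have "integral (cbox a' c') G' = 0"
    using DERIV_const DERIV_unique by blast
  moreover have "integral (cbox a' c') G' = integral (cbox a c) G'"
    by (rule integral_spike_set)
      (use sub[of 0] supp in \<open>auto intro!: negligible_subset[OF negligible_empty]\<close>)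
  ultimately show ?thesis
    by simp
qed

lemma open_hspace: "open (hspace :: ('m::finite) hpoint set)"
  unfolding hspace_def by (intro open_Collect_less continuous_intros)

text \<open>
  In the volume element \<open>y\<^sup>-\<^sup>n dx dy\<close> the operator is in divergence form:
  \<open>y\<^sup>-\<^sup>n \<Delta>\<^sub>n f\<close> is the sum over the coordinate directions \<open>b\<close> of \<open>\<partial>\<^sub>b (y\<^sup>2\<^sup>-\<^sup>n \<partial>\<^sub>b f)\<close>.  Hence the difference
  of the two integrands is a sum of directional derivatives of the fluxes
  \<open>y\<^sup>2\<^sup>-\<^sup>n (f \<partial>\<^sub>b u - u \<partial>\<^sub>b f)\<close>, which have compact support.
\<close>

lemma green_identity_hspace:
  fixes u f :: "('m::finite) hpoint \<Rightarrow> real" and u1 u2 f1 f2 :: "'m hpoint \<Rightarrow> 'm hpoint \<Rightarrow> real"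
  assumes u1: "\<And>b z. b \<in> Basis \<Longrightarrow> z \<in> hspace \<Longrightarrow> ((\<lambda>h. u (z + h *\<^sub>R b)) has_real_derivative u1 b z) (at 0)"
    and u2: "\<And>b z. b \<in> Basis \<Longrightarrow> z \<in> hspace \<Longrightarrow> ((\<lambda>h. u1 b (z + h *\<^sub>R b)) has_real_derivative u2 b z) (at 0)"
    and f1: "\<And>b z. b \<in> Basis \<Longrightarrow> z \<in> hspace \<Longrightarrow> ((\<lambda>h. f (z + h *\<^sub>R b)) has_real_derivative f1 b z) (at 0)"
    and f2: "\<And>b z. b \<in> Basis \<Longrightarrow> z \<in> hspace \<Longrightarrow> ((\<lambda>h. f1 b (z + h *\<^sub>R b)) has_real_derivative f2 b z) (at 0)"
    and cu: "continuous_on hspace u" and cf: "continuous_on hspace f"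
    and cu1: "\<And>b. b \<in> Basis \<Longrightarrow> continuous_on hspace (u1 b)"
    and cf1: "\<And>b. b \<in> Basis \<Longrightarrow> continuous_on hspace (f1 b)"
    and cu2: "\<And>b. b \<in> Basis \<Longrightarrow> continuous_on hspace (u2 b)"
    and cf2: "\<And>b. b \<in> Basis \<Longrightarrow> continuous_on hspace (f2 b)"
    and box: "cbox a c \<subseteq> hspace"
    and supp: "\<And>b z. b \<in> Basis \<Longrightarrow> z \<in> hspace \<Longrightarrow> z \<notin> cbox a c \<Longrightarrow> f z = 0 \<and> f1 b z = 0 \<and> f2 b z = 0"
  shows "integral (cbox a c) (\<lambda>z.
      ((snd z)\<^sup>2 * (\<Sum>b\<in>Basis. u2 b z) - (real CARD('m) - 1) * snd z * u1 (0, 1) z) * f z / snd z ^ (CARD('m) + 1)) =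
    integral (cbox a c) (\<lambda>z.
      u z * ((snd z)\<^sup>2 * (\<Sum>b\<in>Basis. f2 b z) - (real CARD('m) - 1) * snd z * f1 (0, 1) z) / snd z ^ (CARD('m) + 1))"
proof -
  define m where "m = CARD('m)"
  have "m > 0" by (simp add: m_def)
  then obtain l where m: "m = Suc l" using gr0_implies_Suc by blast
  \<comment> \<open>With \<open>n = l + 2\<close>, the flux in direction \<open>b\<close> is \<open>E b z / snd z ^ l\<close>, and \<open>E' b\<close> is its derivative.\<close>
  define E where "E b z = (f z * u1 b z - u z * f1 b z)" for b z
  define E' where "E' b z = (f z * u2 b z - u z * f2 b z) / snd z ^ l
        - snd b * real l * E b z / snd z ^ m" for b z
  have pos: "snd z > 0" if "z \<in> hspace" for z :: "'m hpoint" using that by (simp add: hspace_def)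
  have E'0: "integral (cbox a c) (E' b) = 0" if b: "b \<in> Basis" for b
  proof -
    define G where "G z = (if z \<in> cbox a c then E b z / snd z ^ l else 0)" for z
    define G' where "G' z = (if z \<in> cbox a c then E' b z else 0)" for z
    have GE: "G z = E b z / snd z ^ l" "G' z = E' b z" if "z \<in> hspace" for z
      using supp[OF b that] by (auto simp: G_def G'_def E_def E'_def)
    have G0: "G z = 0" "G' z = 0" if "z \<in> - cbox a c" for z
      using that by (auto simp: G_def G'_def)
    have cover: "(UNIV :: 'm hpoint set) = hspace \<union> - cbox a c" using box by auto
    have opn: "open (- cbox a c)" by (rule open_Compl[OF closed_cbox])
    have line: "open ((\<lambda>h::real. z + h *\<^sub>R b) -` S)" if "open S" for S z
      using that by (intro open_vimage continuous_intros)
    have "integral (cbox a c) G' = 0"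
    proof (rule integral_directional_derivative_eq_0[OF b, of G])
      fix z
      consider "z \<in> hspace" | "z \<in> - cbox a c" using cover by blast
      then show "((\<lambda>h. G (z + h *\<^sub>R b)) has_real_derivative G' z) (at 0)"
      proof cases
        case 1
        have "((\<lambda>h. (f (z + h *\<^sub>R b) * u1 b (z + h *\<^sub>R b) - u (z + h *\<^sub>R b) * f1 b (z + h *\<^sub>R b)) /
             (snd z + h * snd b) ^ l) has_real_derivative G' z) (at 0)"
          by (rule derivative_eq_intros u1 u2 f1 f2 b 1 refl)+
            (use pos[OF 1] m in \<open>simp_all add: GE[OF 1] E'_def E_def field_simps power2_eq_square
               mult_ac power_add[symmetric] split: nat.splits\<close>, cases l, simp_all add: field_simps)
        then show ?thesis
          by (rule has_field_derivative_transform_within_open[OF _ line[OF open_hspace, of z]])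
            (use 1 GE in \<open>auto simp: E_def\<close>)
      next
        case 2
        have "((\<lambda>h. 0) has_real_derivative G' z) (at 0)" using G0[OF 2] by simp
        then show ?thesis
          by (rule has_field_derivative_transform_within_open[OF _ line[OF opn, of z]])
            (use 2 G0 in \<open>auto\<close>)
      qed
    next
      have "continuous_on hspace (\<lambda>z. E b z / snd z ^ l)" unfolding E_def
        by (intro continuous_intros cu cf cu1 cf1 b) (auto dest: pos)
      then show "continuous_on UNIV G" unfolding cover
        using GE G0 by (intro continuous_on_open_Un open_hspace opn) (auto cong: continuous_on_cong_simp)
      have "continuous_on hspace (\<lambda>z. E' b z)" unfolding E_def E'_def
        by (intro continuous_intros cu cf cu1 cf1 cu2 cf2 b) (auto dest: pos)
      then show "continuous_on UNIV G'" unfolding cover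
        using GE G0 by (intro continuous_on_open_Un open_hspace opn) (auto cong: continuous_on_cong_simp)
    qed (use G0 in auto)
    then show ?thesis
      by (subst integral_cong[of _ _ G']) (auto simp: G'_def)
  qed
  have cont: "continuous_on (cbox a c) g" if "continuous_on hspace g" for g :: "'m hpoint \<Rightarrow> real"
    using continuous_on_subset[OF that box] .
  have nz: "snd z ^ j \<noteq> 0" if "z \<in> hspace" for z :: "'m hpoint" and j
    using pos[OF that] by simp
  have "(\<lambda>z. \<Sum>b\<in>Basis. E' b z) integrable_on cbox a c"
    and intE: "\<And>b. b \<in> Basis \<Longrightarrow> E' b integrable_on cbox a c"
    unfolding E_def E'_def
    by (intro integrable_continuous cont continuous_intros cu cf cu1 cf1 cu2 cf2;
        use nz box in blast)+
  have alg: "(f * A - u * C) / y ^ l - real l * (f * p - u * r) / y ^ Suc l =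
      (y\<^sup>2 * A - (real (Suc l) - 1) * y * p) * f / y ^ (Suc l + 1) -
      u * (y\<^sup>2 * C - (real (Suc l) - 1) * y * r) / y ^ (Suc l + 1)"
    if "y > 0" for y f A u C p r :: real
    using that by (simp add: field_simps power2_eq_square)
  have e2: "(0::real^'m, 1::real) \<in> Basis" by (auto simp: Basis_prod_def)
  have "0 = integral (cbox a c) (\<lambda>z. \<Sum>b\<in>Basis. E' b z)"
    using E'0 by (subst integral_sum) (auto intro: intE)
  also have "\<dots> = integral (cbox a c) (\<lambda>z.
      ((snd z)\<^sup>2 * (\<Sum>b\<in>Basis. u2 b z) - (real CARD('m) - 1) * snd z * u1 (0, 1) z) * f z / snd z ^ (CARD('m) + 1)
     - u z * ((snd z)\<^sup>2 * (\<Sum>b\<in>Basis. f2 b z) - (real CARD('m) - 1) * snd z * f1 (0, 1) z) / snd z ^ (CARD('m) + 1))"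
  proof (rule integral_cong)
    fix z assume "z \<in> cbox a c"
    then have y: "snd z > 0" using box pos by blast
    have "(\<Sum>b\<in>Basis. snd b * real l * E b z / snd z ^ m) = real l * E (0,1) z / snd z ^ m"
      unfolding Basis_prod_def
      by (subst sum.union_disjoint) (auto simp: sum.reindex inj_on_def)
    then have "(\<Sum>b\<in>Basis. E' b z) = (\<Sum>b\<in>Basis. (f z * u2 b z - u z * f2 b z) / snd z ^ l) - real l * E (0,1) z / snd z ^ m"
      unfolding E'_def by (simp add: sum_subtractf)
    also have "(\<Sum>b\<in>Basis. (f z * u2 b z - u z * f2 b z) / snd z ^ l) =
       (f z * (\<Sum>b\<in>Basis. u2 b z) - u z * (\<Sum>b\<in>Basis. f2 b z)) / snd z ^ l"
      by (simp add: sum_divide_distrib[symmetric] sum_subtractf sum_distrib_left)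
    finally show "(\<Sum>b\<in>Basis. E' b z) = ((snd z)\<^sup>2 * (\<Sum>b\<in>Basis. u2 b z) - (real CARD('m) - 1) * snd z * u1 (0, 1) z) * f z / snd z ^ (CARD('m) + 1)
     - u z * ((snd z)\<^sup>2 * (\<Sum>b\<in>Basis. f2 b z) - (real CARD('m) - 1) * snd z * f1 (0, 1) z) / snd z ^ (CARD('m) + 1)"
      unfolding m_def[symmetric] m E_def using alg[OF y] by simp
  qed
  finally show ?thesis
    by (subst (asm) integral_diff)
      (auto intro!: integrable_continuous cont continuous_intros cu cf cu1 cf1 cu2 cf2 e2 dest: pos)
qed

section \<open>Functions of the distance to the origin\<close>

text \<open>
  Calculations are done in the variable \<open>q = cosh \<eta>\<close> rather than \<open>\<eta>\<close>: it is a smooth function on the whole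
  half-space, the origin included.
\<close>

definition cosh_dist :: "('m::finite) hpoint \<Rightarrow> real" where
  "cosh_dist z = ((norm (fst z))\<^sup>2 + (snd z)\<^sup>2 + 1) / (2 * snd z)"

lemma hspace_pos: "z \<in> hspace \<Longrightarrow> snd z > 0"
  by (simp add: hspace_def)

text \<open>
  The squared hyperbolic length of the gradient of \<open>cosh \<eta>\<close> is \<open>sinh\<^sup>2 \<eta>\<close>; in coordinates it is the left-hand
  side.  The identity also bounds \<open>|x|\<close> by \<open>cosh \<eta>\<close>.
\<close>

lemma sq_cosh_dist_ident:
  assumes "z \<in> hspace"
  shows "(norm (fst z))\<^sup>2 + (snd z - cosh_dist z)\<^sup>2 = (cosh_dist z)\<^sup>2 - 1"
  using hspace_pos[OF assms] by (simp add: cosh_dist_def field_simps power2_eq_square)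

lemma cosh_dist_ge_1:
  assumes "z \<in> hspace"
  shows "cosh_dist z \<ge> 1"
proof -
  have "0 \<le> (norm (fst z))\<^sup>2 + (snd z - 1)\<^sup>2" by simp
  then show ?thesis
    using hspace_pos[OF assms] by (simp add: cosh_dist_def field_simps power2_eq_square)
qed

lemma cosh_dist_horigin: "cosh_dist horigin = 1"
  by (simp add: cosh_dist_def horigin_def)

lemma hdist_horigin: "hdist horigin z = arcosh (cosh_dist z)" "hdist z horigin = arcosh (cosh_dist z)"
  by (simp_all add: hdist_def horigin_def cosh_dist_def add.assoc add.commute add.left_commute)

lemma horigin_hspace: "horigin \<in> hspace"
  by (simp add: hspace_def horigin_def)

definition cosh_dist_partial :: "('m::finite) hpoint \<Rightarrow> 'm hpoint \<Rightarrow> real" where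
  "cosh_dist_partial b z = fst b \<bullet> fst z / snd z + snd b * (1 - cosh_dist z / snd z)"

text \<open>
  This is the second derivative in direction \<open>b\<close> when \<open>b\<close> is a coordinate vector; for other vectors the mixed
  terms are missing.
\<close>

definition cosh_dist_partial2 :: "('m::finite) hpoint \<Rightarrow> 'm hpoint \<Rightarrow> real" where
  "cosh_dist_partial2 b z = fst b \<bullet> fst b / snd z + snd b * (2 * cosh_dist z / (snd z)\<^sup>2 - 1 / snd z)"

lemma has_derivative_cosh_dist:
  assumes "z \<in> hspace"
  shows "((\<lambda>h. cosh_dist (z + h *\<^sub>R b)) has_real_derivative cosh_dist_partial b z) (at 0)"
proof -
  have y: "snd z > 0" using hspace_pos[OF assms] .
  have "((\<lambda>h. (fst z \<bullet> fst z + 2 * h * (fst b \<bullet> fst z) + h\<^sup>2 * (fst b \<bullet> fst b) + (snd z + h * snd b)\<^sup>2 + 1)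
     / (2 * (snd z + h * snd b))) has_real_derivative cosh_dist_partial b z) (at 0)"
    by (rule derivative_eq_intros refl)+
      (use y in \<open>simp_all add: cosh_dist_partial_def cosh_dist_def field_simps power2_eq_square power2_norm_eq_inner[unfolded power2_eq_square]\<close>)
  moreover have "cosh_dist (z + h *\<^sub>R b) =
      (fst z \<bullet> fst z + 2 * h * (fst b \<bullet> fst z) + h\<^sup>2 * (fst b \<bullet> fst b) + (snd z + h * snd b)\<^sup>2 + 1)
     / (2 * (snd z + h * snd b))" for h
    unfolding cosh_dist_def power2_norm_eq_inner
    by (simp add: inner_add_left inner_add_right inner_commute power2_eq_square)
  ultimately show ?thesis by simp
qed

lemma Basis_hpoint_cases:
  assumes "(b :: ('m::finite) hpoint) \<in> Basis"
  obtains i where "b = (axis i 1, 0)" | "b = (0, 1)"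
  using assms by (auto simp: Basis_prod_def Basis_vec_def)

lemma sum_Basis_hpoint:
  "(\<Sum>b\<in>(Basis :: ('m::finite) hpoint set). g b) = (\<Sum>i\<in>UNIV. g (axis i 1, 0)) + g (0, 1)"
proof -
  have B: "(Basis :: 'm hpoint set) = insert (0, 1) (range (\<lambda>i. (axis i 1, 0)))"
    by (auto simp: Basis_prod_def Basis_vec_def)
  moreover have "inj (\<lambda>i::'m. (axis i (1::real), 0::real))"
    by (auto simp: inj_on_def axis_eq_axis)
  moreover have "(0, 1) \<notin> range (\<lambda>i::'m. (axis i (1::real), 0::real))" by auto
  ultimately show ?thesis
    unfolding B by (subst sum.insert) (auto simp: sum.reindex add.commute)
qed

lemma has_derivative_cosh_dist_partial:
  assumes "z \<in> hspace" "b \<in> Basis"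
  shows "((\<lambda>h. cosh_dist_partial b (z + h *\<^sub>R b)) has_real_derivative cosh_dist_partial2 b z) (at 0)"
proof -
  have y: "snd z > 0" using hspace_pos[OF assms(1)] .
  have d1: "((\<lambda>h. (fst b \<bullet> fst z + h * (fst b \<bullet> fst b)) / (snd z + h * snd b)) has_real_derivative
       ((fst b \<bullet> fst b) * snd z - (fst b \<bullet> fst z) * snd b) / (snd z)\<^sup>2) (at 0)"
    by (rule derivative_eq_intros refl)+ (use y in \<open>simp_all add: power2_eq_square\<close>)
  have d2: "((\<lambda>h. 1 - cosh_dist (z + h *\<^sub>R b) / (snd z + h * snd b)) has_real_derivative
       - (cosh_dist_partial b z * snd z - cosh_dist z * snd b) / (snd z)\<^sup>2) (at 0)"
  proof -
    have "((\<lambda>h. snd z + h * snd b) has_real_derivative snd b) (at 0)"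
      by (rule derivative_eq_intros refl)+ simp
    from DERIV_diff[OF DERIV_const DERIV_divide[OF has_derivative_cosh_dist[OF assms(1), of b] this], of 1]
    show ?thesis using y by (simp add: power2_eq_square minus_divide_left)
  qed
  have "((\<lambda>h. (fst b \<bullet> fst z + h * (fst b \<bullet> fst b)) / (snd z + h * snd b) +
       snd b * (1 - cosh_dist (z + h *\<^sub>R b) / (snd z + h * snd b))) has_real_derivative
       ((fst b \<bullet> fst b) * snd z - (fst b \<bullet> fst z) * snd b) / (snd z)\<^sup>2 +
       snd b * (- (cosh_dist_partial b z * snd z - cosh_dist z * snd b) / (snd z)\<^sup>2)) (at 0)"
    by (intro DERIV_add DERIV_cmult d1 d2)
  also have "((fst b \<bullet> fst b) * snd z - (fst b \<bullet> fst z) * snd b) / (snd z)\<^sup>2 +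
       snd b * (- (cosh_dist_partial b z * snd z - cosh_dist z * snd b) / (snd z)\<^sup>2) = cosh_dist_partial2 b z"
    using assms(2) y
    by (cases rule: Basis_hpoint_cases) (auto simp: cosh_dist_partial2_def cosh_dist_partial_def field_simps power2_eq_square)
  finally show ?thesis
    by (simp add: cosh_dist_partial_def inner_add_right)
qed

lemma continuous_on_cosh_dist: "continuous_on hspace cosh_dist"
  unfolding cosh_dist_def by (intro continuous_intros) (auto dest: hspace_pos)

lemma continuous_on_cosh_dist_partial: "continuous_on hspace (cosh_dist_partial b)"
  unfolding cosh_dist_partial_def by (intro continuous_intros continuous_on_cosh_dist) (auto dest: hspace_pos)

lemma continuous_on_cosh_dist_partial2: "continuous_on hspace (cosh_dist_partial2 b)"
  unfolding cosh_dist_partial2_def by (intro continuous_intros continuous_on_cosh_dist) (auto dest: hspace_pos)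

lemma sum_cosh_dist_partial_sq:
  assumes "z \<in> hspace"
  shows "(snd z)\<^sup>2 * (\<Sum>b\<in>Basis. (cosh_dist_partial b z)\<^sup>2) = (cosh_dist z)\<^sup>2 - 1"
proof -
  have y: "snd z > 0" using hspace_pos[OF assms] .
  have "(\<Sum>i\<in>UNIV. (fst z $ i)\<^sup>2) = (norm (fst z))\<^sup>2"
    by (simp add: norm_vec_def L2_set_def sum_nonneg)
  then have "(\<Sum>b\<in>Basis. (cosh_dist_partial b z)\<^sup>2) = (norm (fst z))\<^sup>2 / (snd z)\<^sup>2 + (1 - cosh_dist z / snd z)\<^sup>2"
    by (simp add: sum_Basis_hpoint cosh_dist_partial_def inner_axis' power_divide sum_divide_distrib[symmetric])
  then show ?thesis
    unfolding sq_cosh_dist_ident[OF assms, symmetric] using y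
    by (simp add: field_simps power2_eq_square)
qed

lemma sum_cosh_dist_partial2:
  fixes z :: "('m::finite) hpoint"
  shows "(\<Sum>b\<in>Basis. cosh_dist_partial2 b z) = real CARD('m) / snd z + (2 * cosh_dist z / (snd z)\<^sup>2 - 1 / snd z)"
  by (simp add: sum_Basis_hpoint cosh_dist_partial2_def inner_axis_axis)

text \<open>
  The Laplacian of a function \<open>g (cosh \<eta>)\<close>, as a function of \<open>w = cosh \<eta>\<close>.  The arguments \<open>g1\<close> and \<open>g2\<close> stand
  for the first two derivatives of \<open>g\<close>; passing them explicitly keeps \<open>deriv\<close> out of the calculations.
\<close>

definition radial_op :: "nat \<Rightarrow> (real \<Rightarrow> real) \<Rightarrow> (real \<Rightarrow> real) \<Rightarrow> real \<Rightarrow> real" where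
  "radial_op n g1 g2 w = (w\<^sup>2 - 1) * g2 w + real n * w * g1 w"

lemma laplace_radial:
  fixes z :: "('m::finite) hpoint"
  assumes "z \<in> hspace"
  shows "(snd z)\<^sup>2 * (\<Sum>b\<in>Basis. g2 (cosh_dist z) * (cosh_dist_partial b z)\<^sup>2 + g1 (cosh_dist z) * cosh_dist_partial2 b z)
     - (real CARD('m) - 1) * snd z * (g1 (cosh_dist z) * cosh_dist_partial (0, 1) z)
    = radial_op (CARD('m) + 1) g1 g2 (cosh_dist z)"
proof -
  have y: "snd z > 0" using hspace_pos[OF assms] .
  have d01: "cosh_dist_partial (0, 1) z = 1 - cosh_dist z / snd z" by (simp add: cosh_dist_partial_def)
  have alg: "G2 * (q\<^sup>2 - 1) + G1 * (y\<^sup>2 * (m / y + (2 * q / y\<^sup>2 - 1 / y))) - (m - 1) * y * (G1 * (1 - q / y)) =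
      (q\<^sup>2 - 1) * G2 + (m + 1) * q * G1" if "y > 0" for y G2 q G1 m :: real
    using that by (simp add: field_simps power2_eq_square)
  have "(snd z)\<^sup>2 * (\<Sum>b\<in>Basis. g2 (cosh_dist z) * (cosh_dist_partial b z)\<^sup>2 + g1 (cosh_dist z) * cosh_dist_partial2 b z) =
     g2 (cosh_dist z) * ((snd z)\<^sup>2 * (\<Sum>b\<in>Basis. (cosh_dist_partial b z)\<^sup>2)) +
     g1 (cosh_dist z) * ((snd z)\<^sup>2 * (\<Sum>b\<in>Basis. cosh_dist_partial2 b z))"
    by (simp add: sum.distrib sum_distrib_left[symmetric] distrib_left mult.left_commute)
  then show ?thesis
    unfolding sum_cosh_dist_partial_sq[OF assms] sum_cosh_dist_partial2 radial_op_def d01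
    using alg[OF y, of "g2 (cosh_dist z)" "cosh_dist z" "g1 (cosh_dist z)" "real CARD('m)"] by simp
qed

text \<open>
  Closed balls of hyperbolic space stay away from the boundary at infinity, so a function with bounded support in
  the variable \<open>q\<close> has compact support in the open half-space.
\<close>

lemma cosh_dist_sublevel_box:
  assumes "R \<ge> 1"
  obtains a c :: "('m::finite) hpoint" where "cbox a c \<subseteq> hspace"
    "\<And>z. z \<in> hspace \<Longrightarrow> cosh_dist z \<le> R \<Longrightarrow> z \<in> cbox a c"
proof
  let ?a = "(vec (- R), 1 / (2 * R)) :: 'm hpoint"
  let ?c = "(vec R, 2 * R) :: 'm hpoint"
  show "cbox ?a ?c \<subseteq> hspace"
  proof
    fix z assume "z \<in> cbox ?a ?c"
    then have "1 / (2 * R) \<le> snd z" by (cases z) (simp add: cbox_Pair_eq)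
    moreover have "0 < 1 / (2 * R)" using assms by simp
    ultimately show "z \<in> hspace" unfolding hspace_def using less_le_trans by blast
  qed
  fix z :: "'m hpoint" assume z: "z \<in> hspace" and R: "cosh_dist z \<le> R"
  have y: "snd z > 0" using hspace_pos[OF z] .
  have "(norm (fst z))\<^sup>2 \<le> (cosh_dist z)\<^sup>2"
    using sq_cosh_dist_ident[OF z] zero_le_power2[of "snd z - cosh_dist z"] by linarith
  then have "norm (fst z) \<le> cosh_dist z"
    by (rule power2_le_imp_le) (use cosh_dist_ge_1[OF z] in linarith)
  then have "norm (fst z) \<le> R" using R by linarith
  then have 1: "\<bar>fst z $ i\<bar> \<le> R" for i using component_le_norm_cart[of "fst z" i] by linarith
  have *: "(norm (fst z))\<^sup>2 + (snd z)\<^sup>2 + 1 \<le> R * (2 * snd z)"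
    using R y unfolding cosh_dist_def by (simp add: pos_divide_le_eq)
  have "1 \<le> R * (2 * snd z)"
    using * zero_le_power2[of "norm (fst z)"] zero_le_power2[of "snd z"] by linarith
  then have 2: "1 / (2 * R) \<le> snd z"
    using assms by (subst pos_divide_le_eq) (auto simp: mult_ac)
  have "snd z * snd z \<le> (2 * R) * snd z"
    using * zero_le_power2[of "norm (fst z)"] unfolding power2_eq_square[of "snd z"] by linarith
  then have 3: "snd z \<le> 2 * R" using y by simp
  have "vec (- R) $ i \<le> fst z $ i" "fst z $ i \<le> vec R $ i" for i
    using 1[of i] by (simp_all add: vec_component abs_le_iff)
  then have "fst z \<in> cbox (vec (- R)) (vec R)"
    by (auto simp: mem_box_cart)
  moreover have "snd z \<in> cbox (1 / (2 * R)) (2 * R)" using 2 3 by (simp only: interval_cbox[symmetric] atLeastAtMost_iff)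
  ultimately show "z \<in> cbox ?a ?c"
    by (cases z) (simp only: cbox_Pair_eq mem_Times_iff fst_conv snd_conv)
qed

text \<open>
  For compactly supported continuous functions the Lebesgue integral over the half-space becomes a
  Henstock--Kurzweil integral over a box, the setting of the Leibniz rule.
\<close>

lemma hvol_set_integral_eq:
  fixes g :: "('m::finite) hpoint \<Rightarrow> real"
  assumes g: "continuous_on hspace g" and box: "cbox a c \<subseteq> hspace"
    and supp: "\<And>z. z \<in> hspace \<Longrightarrow> z \<notin> cbox a c \<Longrightarrow> g z = 0"
  shows "(LINT z:hspace|hvol. g z) = integral (cbox a c) (\<lambda>z. g z / snd z ^ (CARD('m) + 1))"
proof -
  have hvol: "(hvol :: 'm hpoint measure) =
      density lborel (\<lambda>z. ennreal (indicator hspace z / snd z ^ (CARD('m) + 1)))"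
    unfolding hvol_def by (rule arg_cong[of _ _ "density lborel"]) (auto simp: indicator_def)
  have hs: "(hspace :: 'm hpoint set) \<in> sets borel" by (simp add: open_hspace)
  have mg: "(\<lambda>z. indicator hspace z *\<^sub>R g z) \<in> borel_measurable borel"
    by (rule borel_measurable_continuous_on_indicator[OF hs g])
  have md: "(\<lambda>z. indicator hspace z / snd z ^ (CARD('m) + 1)) \<in> borel_measurable (borel :: 'm hpoint measure)"
    using hs borel_measurable_continuous_onI[OF continuous_on_snd[OF continuous_on_id]] by measurable
  have "(LINT z:hspace|hvol. g z) = (LINT z|lborel. (indicator hspace z / snd z ^ (CARD('m) + 1)) *\<^sub>R
       (indicator hspace z *\<^sub>R g z))"
    unfolding set_lebesgue_integral_def hvol
    by (rule integral_density) (use mg md in \<open>auto simp: indicator_def hspace_def\<close>)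
  also have "\<dots> = (LINT z:cbox a c|lborel. g z / snd z ^ (CARD('m) + 1))"
    unfolding set_lebesgue_integral_def using supp box
    by (intro Bochner_Integration.integral_cong) (auto simp: indicator_def)
  also have "\<dots> = integral (cbox a c) (\<lambda>z. g z / snd z ^ (CARD('m) + 1))"
  proof (rule set_borel_integral_eq_integral)
    have "continuous_on hspace (\<lambda>z. g z / snd z ^ (CARD('m) + 1))"
      by (intro continuous_intros g) (auto dest: hspace_pos)
    then show "set_integrable lborel (cbox a c) (\<lambda>z. g z / snd z ^ (CARD('m) + 1))"
      unfolding set_integrable_def
      by (intro borel_integrable_compact compact_cbox) (rule continuous_on_subset[OF _ box])
  qed
  finally show ?thesis .
qed

text \<open>
  Differentiation under the integral sign brings in \<open>\<partial>\<^sub>t u = \<Delta>\<^sub>n u\<close>, and Green's identity moves the Laplacian to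
  the test function.  Compact support of the test function makes both steps independent of the behaviour of \<open>u\<close>
  at infinity.
\<close>

lemma radial_test_function_evolution:
  fixes u :: "('m::finite) hpoint \<Rightarrow> real \<Rightarrow> real"
  assumes C21: "C21_on hspace u"
    and pde: "\<And>z t. z \<in> hspace \<Longrightarrow> t > 0 \<Longrightarrow> deriv (u z) t = hlaplace (\<lambda>z. u z t) z"
    and g1: "\<And>w. w > 0 \<Longrightarrow> (g has_real_derivative g1 w) (at w)"
    and g2: "\<And>w. w > 0 \<Longrightarrow> (g1 has_real_derivative g2 w) (at w)"
    and cg2: "continuous_on {0<..} g2"
    and supp: "\<And>w. w \<ge> R \<Longrightarrow> g w = 0 \<and> g1 w = 0 \<and> g2 w = 0"
    and t: "t > 0"
  shows "((\<lambda>t. LINT z:hspace|hvol. u z t * g (cosh_dist z)) has_real_derivative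
     (LINT z:hspace|hvol. u z t * radial_op (CARD('m) + 1) g1 g2 (cosh_dist z))) (at t)"
proof -
  obtain a c :: "'m hpoint" where box: "cbox a c \<subseteq> hspace"
    and sub: "\<And>z. z \<in> hspace \<Longrightarrow> cosh_dist z \<le> max 1 R \<Longrightarrow> z \<in> cbox a c"
    by (rule cosh_dist_sublevel_box[OF max.cobounded1[of 1 R]]) (rule that)
  have boxD: "z \<in> hspace" if "z \<in> cbox a c" for z
    using that box by blast
  have out: "g (cosh_dist z) = 0 \<and> g1 (cosh_dist z) = 0 \<and> g2 (cosh_dist z) = 0"
    if "z \<in> hspace" "z \<notin> cbox a c" for z
  proof -
    have "\<not> cosh_dist z \<le> max 1 R" using sub[OF that(1)] that(2) by blast
    then show ?thesis using supp[of "cosh_dist z"] by simp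
  qed
  have pos: "cosh_dist z > 0" if "z \<in> hspace" for z :: "'m hpoint"
    using cosh_dist_ge_1[OF that] by simp
  have "continuous_on {0<..} g"
    by (rule DERIV_continuous_on[of _ _ g1]) (simp add: has_field_derivative_at_within g1)
  moreover have "continuous_on {0<..} g1"
    by (rule DERIV_continuous_on[of _ _ g2]) (simp add: has_field_derivative_at_within g2)
  ultimately have "continuous_on {0<..} g" "continuous_on {0<..} g1" by blast+
  note cg = this cg2
  have cq: "continuous_on hspace (\<lambda>z::'m hpoint. f (cosh_dist z))" if "continuous_on {0<..} f" for f :: "real \<Rightarrow> real"
    by (rule continuous_on_compose2[OF that continuous_on_cosh_dist]) (auto dest: pos)
  have fix_t: "continuous_on hspace (\<lambda>z. F z s)"
    if "continuous_on (hspace \<times> {0<..}) (\<lambda>(z, t). F z t)" "s > 0" for F :: "'m hpoint \<Rightarrow> real \<Rightarrow> real" and s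
  proof -
    have "continuous_on hspace (\<lambda>z. case (z, s) of (z, t) \<Rightarrow> F z t)"
      by (rule continuous_on_compose2[OF that(1)]) (use that(2) in \<open>auto intro!: continuous_intros\<close>)
    then show ?thesis by simp
  qed
  note C = C21[unfolded C21_on_def]
  note C0 = C[THEN conjunct1] and Ct = C[THEN conjunct2, THEN conjunct1, rule_format]
    and cdu = C[THEN conjunct2, THEN conjunct2, THEN conjunct1]
    and C1' = C[THEN conjunct2, THEN conjunct2, THEN conjunct2, THEN conjunct1]
    and C2' = C[THEN conjunct2, THEN conjunct2, THEN conjunct2, THEN conjunct2]
  have C1: "(\<lambda>h. u (z + h *\<^sub>R b) s) differentiable (at 0)" if "b \<in> Basis" "z \<in> hspace" "s > 0" for b z s
    using C1' that by blast
  have C1c: "continuous_on (hspace \<times> {0<..}) (\<lambda>(z, t). partial b (\<lambda>z. u z t) z)" if "b \<in> Basis" for b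
    using C1' that by blast
  have C2: "(\<lambda>h. partial b (\<lambda>z. u z s) (z + h *\<^sub>R b)) differentiable (at 0)" if "b \<in> Basis" "z \<in> hspace" "s > 0" for b z s
    using C2' that by blast
  have C2c: "continuous_on (hspace \<times> {0<..}) (\<lambda>(z, t). partial b (partial b (\<lambda>z. u z t)) z)" if "b \<in> Basis" for b
    using C2' that by blast
  have cu: "continuous_on hspace (\<lambda>z. u z s)" if "s > 0" for s
    by (rule fix_t[OF C0 that])
  define W where "W z = snd z ^ (CARD('m) + 1)" for z :: "'m hpoint"
  have W: "\<forall>z\<in>hspace. W z \<noteq> 0" using hspace_pos by (fastforce simp: W_def)
  have cW: "continuous_on S W" for S unfolding W_def by (intro continuous_intros)
  have cont: "continuous_on (cbox a c) F" if "continuous_on hspace F" for F :: "'m hpoint \<Rightarrow> real"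
    using continuous_on_subset[OF that box] .
  have 1: "(LINT z:hspace|hvol. u z s * g (cosh_dist z)) = integral (cbox a c) (\<lambda>z. u z s * g (cosh_dist z) / W z)"
    if "s > 0" for s
    unfolding W_def
  proof (rule hvol_set_integral_eq[OF _ box])
    show "continuous_on hspace (\<lambda>z. u z s * g (cosh_dist z))"
      by (intro continuous_intros cu cq cg that)
  qed (simp add: out)
  have "((\<lambda>s. integral (cbox a c) (\<lambda>z. u z s * g (cosh_dist z) / W z)) has_real_derivative
      integral (cbox a c) (\<lambda>z. deriv (u z) t * g (cosh_dist z) / W z)) (at t within {t/2..2*t})"
  proof (rule leibniz_rule_field_derivative[where fx = "\<lambda>s z. deriv (u z) s * g (cosh_dist z) / W z"])
    fix s z assume s': "s \<in> {t/2..2*t}" and z': "z \<in> cbox a c"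
    have s: "s > 0" using t s' by simp
    note z = boxD[OF z']
    have "u z differentiable (at s)"
      by (rule Ct[OF z s])
    then have "(u z has_real_derivative deriv (u z) s) (at s)"
      by (simp only: DERIV_deriv_iff_real_differentiable)
    then show "((\<lambda>s. u z s * g (cosh_dist z) / W z) has_real_derivative
       deriv (u z) s * g (cosh_dist z) / W z) (at s within {t/2..2*t})"
      by (rule has_field_derivative_at_within[OF DERIV_cdivide[OF DERIV_cmult_right]])
  next
    fix s assume "s \<in> {t/2..2*t}"
    then have "s > 0" using t by auto
    then show "(\<lambda>z. u z s * g (cosh_dist z) / W z) integrable_on cbox a c"
      by (intro integrable_continuous cont continuous_intros cu cq cg cW W)
  next
    have 2: "continuous_on ({t/2..2*t} \<times> cbox a c) (\<lambda>p. deriv (u (snd p)) (fst p))"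
    proof -
      have "(\<lambda>p. (snd p, fst p)) ` ({t/2..2*t} \<times> cbox a c) \<subseteq> hspace \<times> {0<..}"
      proof (rule image_subsetI)
        fix p assume p: "p \<in> {t/2..2*t} \<times> cbox a c"
        then have "fst p > 0" using t by (simp add: mem_Times_iff)
        then show "(snd p, fst p) \<in> hspace \<times> {0<..}"
          using boxD[of "snd p"] p by (simp add: mem_Times_iff)
      qed
      from continuous_on_compose2[OF cdu continuous_on_Pair[OF continuous_on_snd[OF continuous_on_id] continuous_on_fst[OF continuous_on_id]] this] show ?thesis
        by simp
    qed
    have boxsnd: "snd ` ({t/2..2*t} \<times> cbox a c) \<subseteq> hspace"
      using box by (simp add: snd_image_times)
    have 3: "continuous_on ({t/2..2*t} \<times> cbox a c) (\<lambda>p. g (cosh_dist (snd p)) / W (snd p))"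
      by (rule continuous_on_compose2[of hspace "\<lambda>z. g (cosh_dist z) / W z"])
        (rule boxsnd continuous_on_snd continuous_on_id continuous_intros cq cg cW W)+
    show "continuous_on ({t/2..2*t} \<times> cbox a c) (\<lambda>(s, z). deriv (u z) s * g (cosh_dist z) / W z)"
      using continuous_on_mult[OF 2 3] by (simp add: split_beta)
  qed (use t in auto)
  moreover have "at t within {t/2..2*t} = at t" using t by (intro at_within_Icc_at) auto
  ultimately have "((\<lambda>s. integral (cbox a c) (\<lambda>z. u z s * g (cosh_dist z) / W z)) has_real_derivative
      integral (cbox a c) (\<lambda>z. deriv (u z) t * g (cosh_dist z) / W z)) (at t)"
    by simp
  then have "((\<lambda>s. LINT z:hspace|hvol. u z s * g (cosh_dist z)) has_real_derivative
      integral (cbox a c) (\<lambda>z. deriv (u z) t * g (cosh_dist z) / W z)) (at t)"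
    by (rule has_field_derivative_transform_within_open[where S = "{0<..}"]) (use t 1 in auto)
  moreover have "integral (cbox a c) (\<lambda>z. deriv (u z) t * g (cosh_dist z) / W z) =
     (LINT z:hspace|hvol. u z t * radial_op (CARD('m) + 1) g1 g2 (cosh_dist z))"
  proof -
    define v where "v = (\<lambda>z. u z t)"
    define v1 where "v1 b = partial b v" for b
    define v2 where "v2 b = partial b (v1 b)" for b
    define f1 where "f1 b z = g1 (cosh_dist z) * cosh_dist_partial b z" for b z :: "'m hpoint"
    define f2 where "f2 b z = g2 (cosh_dist z) * (cosh_dist_partial b z)\<^sup>2 + g1 (cosh_dist z) * cosh_dist_partial2 b z" for b z :: "'m hpoint"
    have "integral (cbox a c) (\<lambda>z.
      ((snd z)\<^sup>2 * (\<Sum>b\<in>Basis. v2 b z) - (real CARD('m) - 1) * snd z * v1 (0, 1) z) * g (cosh_dist z) / snd z ^ (CARD('m) + 1)) =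
    integral (cbox a c) (\<lambda>z.
      v z * ((snd z)\<^sup>2 * (\<Sum>b\<in>Basis. f2 b z) - (real CARD('m) - 1) * snd z * f1 (0, 1) z) / snd z ^ (CARD('m) + 1))"
    proof (rule green_identity_hspace[OF _ _ _ _ _ _ _ _ _ _ box])
      fix b z :: "'m hpoint" assume b: "b \<in> Basis"
      show "continuous_on hspace (v1 b)" "continuous_on hspace (v2 b)"
        unfolding v1_def v2_def v_def
        by (rule fix_t[OF C1c[OF b] t], rule fix_t[OF C2c[OF b] t])
      show "continuous_on hspace (f1 b)" "continuous_on hspace (f2 b)"
        unfolding f1_def f2_def
        by (intro continuous_intros continuous_on_cosh_dist_partial continuous_on_cosh_dist_partial2 cq cg)+
      assume z: "z \<in> hspace"
      show "((\<lambda>h. v (z + h *\<^sub>R b)) has_real_derivative v1 b z) (at 0)"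
        "((\<lambda>h. v1 b (z + h *\<^sub>R b)) has_real_derivative v2 b z) (at 0)"
        unfolding v1_def v2_def v_def
        using C1[OF b z t] C2[OF b z t]
        by (simp_all add: DERIV_deriv_iff_real_differentiable partial_def[of b _ z])
      have q: "((\<lambda>h. cosh_dist (z + h *\<^sub>R b)) has_real_derivative cosh_dist_partial b z) (at 0)"
        by (rule has_derivative_cosh_dist[OF z])
      have "(g has_real_derivative g1 (cosh_dist (z + 0 *\<^sub>R b))) (at (cosh_dist (z + 0 *\<^sub>R b)))"
        "(g1 has_real_derivative g2 (cosh_dist (z + 0 *\<^sub>R b))) (at (cosh_dist (z + 0 *\<^sub>R b)))"
        using g1 g2 pos[OF z] by auto
      note chain = DERIV_chain2[OF this(1) q] DERIV_chain2[OF this(2) q]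
      show "((\<lambda>h. g (cosh_dist (z + h *\<^sub>R b))) has_real_derivative f1 b z) (at 0)"
        using chain(1) by (simp add: f1_def)
      show "((\<lambda>h. f1 b (z + h *\<^sub>R b)) has_real_derivative f2 b z) (at 0)"
        using DERIV_mult[OF chain(2) has_derivative_cosh_dist_partial[OF z b]]
        by (simp add: f1_def f2_def power2_eq_square algebra_simps)
      assume "z \<notin> cbox a c"
      then show "g (cosh_dist z) = 0 \<and> f1 b z = 0 \<and> f2 b z = 0"
        using out[OF z] by (simp add: f1_def f2_def)
    qed (auto simp: v_def intro!: cu t cq cg)
    moreover have "integral (cbox a c) (\<lambda>z. deriv (u z) t * g (cosh_dist z) / W z) =
      integral (cbox a c) (\<lambda>z.
      ((snd z)\<^sup>2 * (\<Sum>b\<in>Basis. v2 b z) - (real CARD('m) - 1) * snd z * v1 (0, 1) z) * g (cosh_dist z) / snd z ^ (CARD('m) + 1))"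
      using boxD t by (intro integral_cong)
        (simp add: pde hlaplace_def W_def v_def v1_def v2_def sum_Basis_hpoint)
    moreover have "integral (cbox a c) (\<lambda>z.
      v z * ((snd z)\<^sup>2 * (\<Sum>b\<in>Basis. f2 b z) - (real CARD('m) - 1) * snd z * f1 (0, 1) z) / snd z ^ (CARD('m) + 1)) =
       integral (cbox a c) (\<lambda>z. u z t * radial_op (CARD('m) + 1) g1 g2 (cosh_dist z) / snd z ^ (CARD('m) + 1))"
      unfolding f1_def f2_def v_def using laplace_radial[of _ g2 g1, OF boxD]
      by (intro integral_cong) simp
    moreover have "\<dots> = (LINT z:hspace|hvol. u z t * radial_op (CARD('m) + 1) g1 g2 (cosh_dist z))"
    proof (rule hvol_set_integral_eq[OF _ box, symmetric])
      show "continuous_on hspace (\<lambda>z. u z t * radial_op (CARD('m) + 1) g1 g2 (cosh_dist z))"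
        unfolding radial_op_def by (intro continuous_intros cu cq cg t continuous_on_cosh_dist)
    qed (simp add: out radial_op_def)
    ultimately show ?thesis by simp
  qed
  ultimately show ?thesis by simp
qed

section \<open>The radial process of hyperbolic Brownian motion\<close>

text \<open>
  The Markov property at time \<open>0\<close>: there the transition probability is almost surely a constant, since the process
  starts at the origin, and taking expectations removes the conditioning.
\<close>

lemma hyperbolic_bm_prob:
  fixes B :: "real \<Rightarrow> 'w \<Rightarrow> ('m::finite) hpoint"
  assumes bm: "hyperbolic_bm M K B" and t: "t > 0" and A: "A \<in> sets borel"
  shows "measure M (B t -` A \<inter> space M) = (LINT z:A|hvol. K horigin z t)"
proof -
  have M: "prob_space M"
    and meas: "\<And>t. t \<ge> 0 \<Longrightarrow> B t \<in> borel_measurable M"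
    and start: "AE \<omega> in M. B 0 \<omega> = horigin"
    and markov: "AE \<omega> in M. real_cond_exp M (past M B 0) (indicator (B t -` A \<inter> space M)) \<omega>
                     = (LINT z:A|hvol. K (B 0 \<omega>) z (t - 0))"
    using bm t A unfolding hyperbolic_bm_def by blast+
  interpret prob_space M by (rule M)
  have gen: "{B r -` A \<inter> space M | r A. 0 \<le> r \<and> r \<le> 0 \<and> A \<in> sets borel} \<subseteq> sets M"
    using measurable_sets[OF meas] by blast
  have "subalgebra M (past M B 0)"
    unfolding subalgebra_def past_def
  proof (intro conjI)
    show "space (sigma (space M) {B r -` A \<inter> space M | r A. 0 \<le> r \<and> r \<le> 0 \<and> A \<in> sets borel}) = space M"
      by (rule space_measure_of) blast
    show "sets (sigma (space M) {B r -` A \<inter> space M | r A. 0 \<le> r \<and> r \<le> 0 \<and> A \<in> sets borel}) \<subseteq> sets M"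
      using gen by (subst sets_measure_of) (blast, rule sets.sigma_sets_subset)
  qed
  then interpret finite_measure_subalgebra M "past M B 0"
    by unfold_locales
  have [measurable]: "B t -` A \<inter> space M \<in> sets M"
    using measurable_sets[OF meas A] t by simp
  have int: "integrable M (indicator (B t -` A \<inter> space M) :: _ \<Rightarrow> real)"
    by (simp add: emeasure_eq_measure)
  have "measure M (B t -` A \<inter> space M) = (\<integral>\<omega>. indicator (B t -` A \<inter> space M) \<omega> \<partial>M)"
    by simp
  also have "\<dots> = (\<integral>\<omega>. real_cond_exp M (past M B 0) (indicator (B t -` A \<inter> space M)) \<omega> \<partial>M)"
    by (rule real_cond_exp_int(2)[OF int, symmetric])
  also have "\<dots> = (\<integral>\<omega>. (LINT z:A|hvol. K horigin z t) \<partial>M)"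
  proof (rule integral_cong_AE)
    show "AE \<omega> in M. real_cond_exp M (past M B 0) (indicator (B t -` A \<inter> space M)) \<omega> = (LINT z:A|hvol. K horigin z t)"
      using markov start by eventually_elim simp
  qed (simp_all add: borel_measurable_cond_exp2)
  also have "\<dots> = (LINT z:A|hvol. K horigin z t)"
    by (simp add: prob_space)
  finally show ?thesis .
qed

lemma cosh_dist_borel [measurable]: "cosh_dist \<in> borel_measurable (borel :: ('m::finite) hpoint measure)"
proof -
  have [measurable]: "fst \<in> borel_measurable (borel :: 'm hpoint measure)"
    "snd \<in> borel_measurable (borel :: 'm hpoint measure)"
    by (auto intro!: borel_measurable_continuous_onI continuous_intros)
  have "(\<lambda>z::'m hpoint. ((norm (fst z))\<^sup>2 + (snd z)\<^sup>2 + 1) / (2 * snd z)) \<in> borel_measurable borel"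
    by measurable
  then show ?thesis by (simp add: cosh_dist_def[abs_def])
qed

text \<open>
  The law of \<open>B\<^sub>t\<close> has the density \<open>k\<close> with respect to the volume.  Both \<open>k (hdist z horigin) t\<close> and \<open>g\<close> are
  controlled only where \<open>z\<close> is in the half-space and \<open>cosh_dist z\<close> is positive, so measurability is first restored
  by cutting them off with indicators.
\<close>

lemma hyperbolic_bm_radial_expectation:
  fixes B :: "real \<Rightarrow> 'w \<Rightarrow> ('m::finite) hpoint" and k :: "real \<Rightarrow> real \<Rightarrow> real"
  assumes bm: "hyperbolic_bm M (\<lambda>z z' t. k (hdist z z') t) B" and t: "t > 0"
    and kcont: "continuous_on hspace (\<lambda>z. k (hdist z (horigin :: 'm hpoint)) t)"
    and knonneg: "\<And>z. z \<in> hspace \<Longrightarrow> k (hdist z (horigin :: 'm hpoint)) t \<ge> 0"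
    and g: "continuous_on {0<..} g"
  shows "(\<lambda>\<omega>. g (cosh_dist (B t \<omega>))) \<in> borel_measurable M"
    and "(\<integral>\<omega>. g (cosh_dist (B t \<omega>)) \<partial>M) =
      (LINT z:hspace|hvol. k (hdist z (horigin :: 'm hpoint)) t * g (cosh_dist z))"
proof -
  have M: "prob_space M"
    and Bm: "B t \<in> borel_measurable M"
    and Bh: "\<And>\<omega>. \<omega> \<in> space M \<Longrightarrow> B t \<omega> \<in> hspace"
    using bm t unfolding hyperbolic_bm_def by (blast intro: less_imp_le)+
  interpret prob_space M by (rule M)
  note [measurable] = Bm
  have hs[measurable]: "(hspace :: 'm hpoint set) \<in> sets borel" by (simp add: open_hspace)
  have sets_hvol [measurable_cong]: "sets (hvol :: 'm hpoint measure) = sets borel"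
    by (simp add: hvol_def)
  define \<rho> where "\<rho> z = indicator hspace z * k (hdist z horigin) t" for z :: "'m hpoint"
  have \<rho>m[measurable]: "\<rho> \<in> borel_measurable borel"
    using borel_measurable_continuous_on_indicator[OF hs kcont] by (simp add: \<rho>_def[abs_def])
  have \<rho>0: "\<rho> z \<ge> 0" for z
    using knonneg by (simp add: \<rho>_def indicator_def)
  have prob_eq: "prob (B t -` A \<inter> space M) = (\<integral>z. indicator A z * \<rho> z \<partial>hvol)" if A: "A \<in> sets borel" for A
  proof -
    have "B t -` A \<inter> space M = B t -` (A \<inter> hspace) \<inter> space M" using Bh by auto
    then have "prob (B t -` A \<inter> space M) = (LINT z:A \<inter> hspace|hvol. k (hdist horigin z) t)"
      using hyperbolic_bm_prob[OF bm t, of "A \<inter> hspace"] A hs by simp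
    also have "\<dots> = (\<integral>z. indicator A z * \<rho> z \<partial>hvol)"
      unfolding set_lebesgue_integral_def
      by (intro Bochner_Integration.integral_cong) (auto simp: \<rho>_def indicator_def hdist_horigin)
    finally show ?thesis .
  qed
  \<comment> \<open>A non-integrable function has integral \<open>0\<close> by convention, so total mass one yields integrability.\<close>
  have "(\<integral>z. \<rho> z \<partial>hvol) = 1"
    using prob_eq[of UNIV] prob_space by simp
  then have \<rho>int: "integrable hvol \<rho>"
    using not_integrable_integral_eq by fastforce
  have distr: "distr M borel (B t) = density hvol \<rho>"
  proof (rule measure_eqI)
    fix A assume "A \<in> sets (distr M borel (B t))"
    then have A[measurable]: "A \<in> sets borel" by simp
    have "integrable hvol (\<lambda>z. indicator A z * \<rho> z)"
      using integrable_mult_indicator[OF _ \<rho>int, of A] by simp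
    then have "(\<integral>\<^sup>+ z. ennreal (indicator A z * \<rho> z) \<partial>hvol) = ennreal (\<integral>z. indicator A z * \<rho> z \<partial>hvol)"
      by (rule nn_integral_eq_integral) (simp add: \<rho>0)
    moreover have "emeasure (density hvol \<rho>) A = (\<integral>\<^sup>+ z. ennreal (indicator A z * \<rho> z) \<partial>hvol)"
      by (subst emeasure_density) (auto intro!: nn_integral_cong simp: indicator_def)
    ultimately show "emeasure (distr M borel (B t)) A = emeasure (density hvol \<rho>) A"
      by (simp add: emeasure_distr emeasure_eq_measure prob_eq)
  qed (simp add: sets_hvol)
  define g' where "g' w = indicator {0<..} w *\<^sub>R g w" for w
  have [measurable]: "g' \<in> borel_measurable borel"
    unfolding g'_def[abs_def] by (rule borel_measurable_continuous_on_indicator[OF _ g]) simp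
  have g': "g' (cosh_dist z) = g (cosh_dist z)" if "z \<in> hspace" for z :: "'m hpoint"
    using cosh_dist_ge_1[OF that] by (simp add: g'_def)
  have "(\<lambda>\<omega>. g' (cosh_dist (B t \<omega>))) \<in> borel_measurable M" by measurable
  then show "(\<lambda>\<omega>. g (cosh_dist (B t \<omega>))) \<in> borel_measurable M"
    by (rule measurable_cong[THEN iffD1, rotated]) (simp add: g' Bh)
  have "(\<integral>\<omega>. g (cosh_dist (B t \<omega>)) \<partial>M) = (\<integral>\<omega>. g' (cosh_dist (B t \<omega>)) \<partial>M)"
    by (intro Bochner_Integration.integral_cong) (simp_all add: g' Bh)
  also have "\<dots> = (\<integral>z. g' (cosh_dist z) \<partial>distr M borel (B t))"
    by (subst integral_distr) simp_all
  also have "\<dots> = (\<integral>z. \<rho> z *\<^sub>R g' (cosh_dist z) \<partial>hvol)"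
    unfolding distr by (rule integral_density) (auto simp: \<rho>0)
  also have "\<dots> = (LINT z:hspace|hvol. k (hdist z (horigin :: 'm hpoint)) t * g (cosh_dist z))"
    unfolding set_lebesgue_integral_def
    by (intro Bochner_Integration.integral_cong) (auto simp: \<rho>_def indicator_def g')
  finally show "(\<integral>\<omega>. g (cosh_dist (B t \<omega>)) \<partial>M) =
      (LINT z:hspace|hvol. k (hdist z (horigin :: 'm hpoint)) t * g (cosh_dist z))" .
qed

text \<open>
  What the later sections use about \<open>q t = cosh (D t)\<close>: its one-time laws solve the forward equation of the radial operator, tested
  against compactly supported functions only, and start at \<open>cosh 0 = 1\<close>.  Values of test functions matter
  only on \<open>[1, \<infinity>)\<close>; they are taken on \<open>(0, \<infinity>)\<close> so that derivatives at \<open>1\<close> are two-sided.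
\<close>

locale hyperbolic_radial = prob_space M for M :: "'w measure" +
  fixes n :: nat and q :: "real \<Rightarrow> 'w \<Rightarrow> real"
  assumes n_ge_2: "n \<ge> 2"
    and q_measurable: "\<And>(g :: real \<Rightarrow> real) t. continuous_on {0<..} g \<Longrightarrow> t > 0 \<Longrightarrow> (\<lambda>\<omega>. g (q t \<omega>)) \<in> borel_measurable M"
    and q_ge_1: "\<And>t \<omega>. t > 0 \<Longrightarrow> \<omega> \<in> space M \<Longrightarrow> q t \<omega> \<ge> 1"
    and evolution: "\<And>g g1 g2 R t.
        (\<And>w. w > 0 \<Longrightarrow> (g has_real_derivative g1 w) (at w)) \<Longrightarrow>
        (\<And>w. w > 0 \<Longrightarrow> (g1 has_real_derivative g2 w) (at w)) \<Longrightarrow>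
        continuous_on {0<..} g2 \<Longrightarrow>
        (\<And>w. w \<ge> R \<Longrightarrow> g w = 0 \<and> g1 w = 0 \<and> g2 w = 0) \<Longrightarrow> t > 0 \<Longrightarrow>
        ((\<lambda>t. expectation (\<lambda>\<omega>. g (q t \<omega>))) has_real_derivative
          expectation (\<lambda>\<omega>. radial_op n g1 g2 (q t \<omega>))) (at t)"
    and initial: "\<And>g :: real \<Rightarrow> real. continuous_on {0<..} g \<Longrightarrow> bounded (g ` {1..}) \<Longrightarrow>
        ((\<lambda>t. expectation (\<lambda>\<omega>. g (q t \<omega>))) \<longlongrightarrow> g 1) (at_right 0)"

text \<open>
  The kernel depends on the distance alone, hence is symmetric: the transition density from the origin to \<open>z\<close> is
  the solution \<open>k (hdist z horigin) t\<close> with pole at the origin.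
\<close>

lemma hyperbolic_bm_imp_hyperbolic_radial:
  fixes B :: "real \<Rightarrow> 'w \<Rightarrow> ('m::finite) hpoint" and k :: "real \<Rightarrow> real \<Rightarrow> real"
  assumes hk: "heat_kernel (\<lambda>z (z' :: 'm hpoint) t. k (hdist z z') t)"
    and bm: "hyperbolic_bm M (\<lambda>z z' t. k (hdist z z') t) B"
  shows "hyperbolic_radial M (CARD('m) + 1) (\<lambda>t \<omega>. cosh_dist (B t \<omega>))"
proof -
  define u where "u = (\<lambda>(z :: 'm hpoint) t. k (hdist z horigin) t)"
  note hk' = hk[unfolded heat_kernel_def, rule_format, OF horigin_hspace]
  have u0: "u z t \<ge> 0" if "z \<in> hspace" "t > 0" for z t
    using hk'[THEN conjunct1] that unfolding u_def by blast
  have C21: "C21_on hspace u"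
    using hk'[THEN conjunct2, THEN conjunct1] unfolding u_def .
  have pde: "deriv (u z) t = hlaplace (\<lambda>z. u z t) z" if "z \<in> hspace" "t > 0" for z t
    using hk'[THEN conjunct2, THEN conjunct2, THEN conjunct1] that unfolding u_def by blast
  have init: "((\<lambda>t. LINT z:hspace|hvol. u z t * f z) \<longlongrightarrow> f horigin) (at_right 0)"
    if "continuous_on hspace f" "bounded (f ` hspace)" for f
    using hk'[THEN conjunct2, THEN conjunct2, THEN conjunct2] that unfolding u_def by blast
  have cu: "continuous_on hspace (\<lambda>z. u z t)" if "t > 0" for t
  proof -
    have "continuous_on (hspace \<times> {0<..}) (\<lambda>(z, t). u z t)"
      using C21 unfolding C21_on_def by (rule conjunct1)
    then have "continuous_on hspace (\<lambda>z. case (z, t) of (z, t) \<Rightarrow> u z t)"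
      by (rule continuous_on_compose2) (use that in \<open>auto intro!: continuous_intros\<close>)
    then show ?thesis by simp
  qed
  have meas: "(\<lambda>\<omega>. g (cosh_dist (B t \<omega>))) \<in> borel_measurable M"
    and expect: "(\<integral>\<omega>. g (cosh_dist (B t \<omega>)) \<partial>M) = (LINT z:hspace|hvol. u z t * g (cosh_dist z))"
    if "t > 0" "continuous_on {0<..} g" for t g
    using hyperbolic_bm_radial_expectation[OF bm that(1) _ _ that(2)] cu[OF that(1)] u0[OF _ that(1)]
    unfolding u_def by simp_all
  have M: "prob_space M" and Bh: "\<And>t \<omega>. t > 0 \<Longrightarrow> \<omega> \<in> space M \<Longrightarrow> B t \<omega> \<in> hspace"
    using bm unfolding hyperbolic_bm_def by (blast intro: less_imp_le)+
  interpret prob_space M by (rule M)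
  show ?thesis
  proof
    show "2 \<le> CARD('m) + 1"
      by (simp add: Suc_le_eq)
    show "(\<lambda>\<omega>. g (cosh_dist (B t \<omega>))) \<in> borel_measurable M" if "continuous_on {0<..} g" "t > 0" for g :: "real \<Rightarrow> real" and t
      by (rule meas[OF that(2,1)])
    show "1 \<le> cosh_dist (B t \<omega>)" if "t > 0" "\<omega> \<in> space M" for t \<omega>
      by (rule cosh_dist_ge_1[OF Bh[OF that]])
  next
    fix g g1 g2 :: "real \<Rightarrow> real" and R t :: real
    assume g1: "\<And>w. w > 0 \<Longrightarrow> (g has_real_derivative g1 w) (at w)"
      and g2: "\<And>w. w > 0 \<Longrightarrow> (g1 has_real_derivative g2 w) (at w)"
      and cg2: "continuous_on {0<..} g2"
      and supp: "\<And>w. w \<ge> R \<Longrightarrow> g w = 0 \<and> g1 w = 0 \<and> g2 w = 0"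
      and t: "t > 0"
    have cg: "continuous_on {0<..} g"
      by (rule DERIV_continuous_on[of _ _ g1]) (simp add: has_field_derivative_at_within g1)
    have cg1: "continuous_on {0<..} g1"
      by (rule DERIV_continuous_on[of _ _ g2]) (simp add: has_field_derivative_at_within g2)
    have cL: "continuous_on {0<..} (radial_op (CARD('m) + 1) g1 g2)"
      unfolding radial_op_def by (intro continuous_intros cg1 cg2)
    have "((\<lambda>t. LINT z:hspace|hvol. u z t * g (cosh_dist z)) has_real_derivative
       (LINT z:hspace|hvol. u z t * radial_op (CARD('m) + 1) g1 g2 (cosh_dist z))) (at t)"
      by (rule radial_test_function_evolution[OF C21 pde g1 g2 cg2 supp t])
    then have "((\<lambda>t. LINT z:hspace|hvol. u z t * g (cosh_dist z)) has_real_derivative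
        expectation (\<lambda>\<omega>. radial_op (CARD('m) + 1) g1 g2 (cosh_dist (B t \<omega>)))) (at t)"
      by (simp only: expect[OF t cL])
    then show "((\<lambda>t. expectation (\<lambda>\<omega>. g (cosh_dist (B t \<omega>)))) has_real_derivative
        expectation (\<lambda>\<omega>. radial_op (CARD('m) + 1) g1 g2 (cosh_dist (B t \<omega>)))) (at t)"
      by (rule has_field_derivative_transform_within_open[where S = "{0<..}"])
        (use t expect[OF _ cg] in simp_all)
  next
    fix g :: "real \<Rightarrow> real"
    assume cg: "continuous_on {0<..} g" and bg: "bounded (g ` {1..})"
    have "continuous_on hspace (\<lambda>z::'m hpoint. g (cosh_dist z))"
      by (rule continuous_on_compose2[OF cg continuous_on_cosh_dist])
        (use cosh_dist_ge_1 in \<open>force\<close>)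
    moreover have "bounded ((\<lambda>z::'m hpoint. g (cosh_dist z)) ` hspace)"
      by (rule bounded_subset[OF bg]) (use cosh_dist_ge_1 in blast)
    ultimately have "((\<lambda>t. LINT z:hspace|hvol. u z t * g (cosh_dist z)) \<longlongrightarrow> g 1) (at_right 0)"
      using init[of "\<lambda>z. g (cosh_dist z)"] by (simp add: cosh_dist_horigin)
    moreover have "\<forall>\<^sub>F t in at_right 0. expectation (\<lambda>\<omega>. g (cosh_dist (B t \<omega>))) =
        (LINT z:hspace|hvol. u z t * g (cosh_dist z))"
      using expect[OF _ cg] by (auto simp: eventually_at_right_field intro: exI[of _ 1])
    ultimately show "((\<lambda>t. expectation (\<lambda>\<omega>. g (cosh_dist (B t \<omega>)))) \<longlongrightarrow> g 1) (at_right 0)"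
      by (subst tendsto_cong)
  qed
qed

section \<open>Comparison with sub- and supersolutions\<close>

lemma has_derivative_pos_part_power:
  fixes x :: real
  assumes "n \<ge> 2"
  shows "((\<lambda>x. max 0 x ^ n) has_real_derivative real n * max 0 x ^ (n - 1)) (at x)"
proof -
  obtain m where n: "n = Suc (Suc m)" using assms by (metis add_2_eq_Suc le_Suc_ex)
  consider "x < 0" | "x = 0" | "x > 0" by linarith
  then show ?thesis
  proof cases
    case 1
    have "((\<lambda>x. 0) has_real_derivative 0) (at x)" by simp
    then have "((\<lambda>x. max 0 x ^ n) has_real_derivative 0) (at x)"
      by (rule has_field_derivative_transform_within_open[where S = "{..<0}"]) (use 1 n in auto)
    then show ?thesis using 1 n by simp
  next
    case 2
    have "((\<lambda>h. \<bar>h\<bar> ^ Suc m) \<longlongrightarrow> \<bar>0\<bar> ^ Suc m) (at (0::real))"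
      by (intro tendsto_intros)
    then have lim: "((\<lambda>h. \<bar>h\<bar> ^ Suc m) \<longlongrightarrow> 0) (at (0::real))" by simp
    have "((\<lambda>h::real. max 0 h ^ n / h) \<longlongrightarrow> 0) (at 0)"
      by (rule Lim_null_comparison[OF _ lim])
        (auto simp: eventually_at n max_def abs_mult power_abs mult_nonpos_nonneg intro!: exI[of _ 1])
    then show ?thesis using 2 n by (simp add: DERIV_def)
  next
    case 3
    have "((\<lambda>x. x ^ n) has_real_derivative real n * x ^ (n - 1)) (at x)"
      using DERIV_pow[of n x UNIV] by simp
    then have "((\<lambda>x. max 0 x ^ n) has_real_derivative real n * x ^ (n - 1)) (at x)"
      by (rule has_field_derivative_transform_within_open[where S = "{0<..}"]) (use 3 in auto)
    then show ?thesis using 3 by simp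
  qed
qed

text \<open>
  A twice continuously differentiable cutoff that vanishes beyond hyperbolic distance about \<open>R\<close>.  In terms of \<open>ln w\<close>, which is
  comparable to the distance, the radial operator has bounded coefficients; the derivatives of the cutoff therefore
  contribute \<open>O(1/R)\<close>, whereas a cutoff in \<open>w / R\<close> would contribute \<open>O(1)\<close>.  The two functions that follow are
  its derivatives.
\<close>

definition log_cutoff :: "real \<Rightarrow> real \<Rightarrow> real" where
  "log_cutoff R w = max 0 (1 - ln w / R) ^ 3"

definition log_cutoff1 :: "real \<Rightarrow> real \<Rightarrow> real" where
  "log_cutoff1 R w = - (3 * max 0 (1 - ln w / R) ^ 2) / (R * w)"

definition log_cutoff2 :: "real \<Rightarrow> real \<Rightarrow> real" where
  "log_cutoff2 R w = 6 * max 0 (1 - ln w / R) / (R * w)\<^sup>2 + 3 * max 0 (1 - ln w / R) ^ 2 / (R * w\<^sup>2)"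

lemma log_cutoff_derivatives:
  assumes R: "R > 0" and w: "w > 0"
  shows "(log_cutoff R has_real_derivative log_cutoff1 R w) (at w)"
    and "(log_cutoff1 R has_real_derivative log_cutoff2 R w) (at w)"
proof -
  have inner: "((\<lambda>w. 1 - ln w / R) has_real_derivative - (1 / (R * w))) (at w)"
    using DERIV_diff[OF DERIV_const DERIV_cdivide[OF DERIV_ln_divide[OF w], of R], of 1]
    by (simp add: mult.commute)
  have c3: "((\<lambda>w. max 0 (1 - ln w / R) ^ 3) has_real_derivative (3 * max 0 (1 - ln w / R) ^ 2) * - (1 / (R * w))) (at w)"
    using DERIV_chain2[OF has_derivative_pos_part_power[of 3] inner] by simp
  then show "(log_cutoff R has_real_derivative log_cutoff1 R w) (at w)"
    by (simp add: log_cutoff_def[abs_def] log_cutoff1_def)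
  have c2: "((\<lambda>w. max 0 (1 - ln w / R) ^ 2) has_real_derivative (2 * max 0 (1 - ln w / R)) * - (1 / (R * w))) (at w)"
    using DERIV_chain2[OF has_derivative_pos_part_power[of 2] inner] by simp
  have "((\<lambda>w. - 3 / R * (max 0 (1 - ln w / R) ^ 2 / w)) has_real_derivative
     - 3 / R * (((2 * max 0 (1 - ln w / R)) * - (1 / (R * w)) * w - max 0 (1 - ln w / R) ^ 2 * 1) / (w * w))) (at w)"
    by (intro DERIV_cmult DERIV_divide c2 DERIV_ident) (use w in simp)
  moreover have "- 3 / R * (((2 * max 0 (1 - ln w / R)) * - (1 / (R * w)) * w - max 0 (1 - ln w / R) ^ 2 * 1) / (w * w)) = log_cutoff2 R w"
  proof -
    have "- 3 / R * (((2 * p) * - (1 / (R * w)) * w - s * 1) / (w * w)) = 6 * p / (R * w)\<^sup>2 + 3 * s / (R * w\<^sup>2)" for p s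
      using R w by (simp add: field_simps power2_eq_square)
    then show ?thesis by (simp add: log_cutoff2_def)
  qed
  ultimately show "(log_cutoff1 R has_real_derivative log_cutoff2 R w) (at w)"
    by (simp add: log_cutoff1_def[abs_def])
qed

lemma log_cutoff_bounds:
  assumes R: "R \<ge> 1" and w: "w \<ge> 1"
  shows "0 \<le> log_cutoff R w" "log_cutoff R w \<le> 1"
    and "\<bar>log_cutoff1 R w\<bar> \<le> 3 / (R * w)"
    and "\<bar>log_cutoff2 R w\<bar> \<le> 9 / (R * w\<^sup>2)"
proof -
  define p where "p = max 0 (1 - ln w / R)"
  have p: "0 \<le> p" "p \<le> 1" using R w by (auto simp: p_def)
  then have p2: "0 \<le> p ^ k" "p ^ k \<le> 1" for k by (auto intro: power_le_one)
  show "0 \<le> log_cutoff R w" "log_cutoff R w \<le> 1"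
    using p2 by (simp_all add: log_cutoff_def p_def)
  have "\<bar>log_cutoff1 R w\<bar> = 3 * p ^ 2 / (R * w)"
    using R w p2[of 2] by (simp add: log_cutoff1_def p_def[symmetric] abs_mult abs_divide)
  also have "\<dots> \<le> 3 / (R * w)"
    using R w p2[of 2] by (intro divide_right_mono) auto
  finally show "\<bar>log_cutoff1 R w\<bar> \<le> 3 / (R * w)" .
  have "R * w\<^sup>2 \<le> (R * w)\<^sup>2"
    using R w by (simp add: power2_eq_square mult_ac)
  then have "6 * p / (R * w)\<^sup>2 \<le> 6 / (R * w\<^sup>2)"
    using p R w by (intro frac_le) auto
  moreover have "3 * p ^ 2 / (R * w\<^sup>2) \<le> 3 / (R * w\<^sup>2)"
    using R w p2[of 2] by (intro divide_right_mono) auto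
  moreover have "0 \<le> log_cutoff2 R w"
    using R p p2[of 2] by (simp add: log_cutoff2_def p_def[symmetric])
  moreover have "6 / (R * w\<^sup>2) + 3 / (R * w\<^sup>2) = 9 / (R * w\<^sup>2)"
    by (simp add: add_divide_distrib[symmetric])
  ultimately show "\<bar>log_cutoff2 R w\<bar> \<le> 9 / (R * w\<^sup>2)"
    by (simp add: log_cutoff2_def p_def[symmetric])
qed

text \<open>
  The product rule; every term in which a derivative hits the cutoff is at most a multiple of \<open>G / R\<close>.
\<close>

lemma radial_op_log_cutoff:
  assumes R: "R \<ge> 1" and w: "w \<ge> 1"
    and G: "\<bar>\<phi> w\<bar> \<le> G" "\<bar>w * \<phi>1 w\<bar> \<le> G"
  shows "radial_op n (\<lambda>w. \<phi>1 w * log_cutoff R w + \<phi> w * log_cutoff1 R w)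
      (\<lambda>w. \<phi>2 w * log_cutoff R w + 2 * \<phi>1 w * log_cutoff1 R w + \<phi> w * log_cutoff2 R w) w \<ge>
    log_cutoff R w * radial_op n \<phi>1 \<phi>2 w - (15 + 3 * real n) * G / R"
proof -
  let ?c1 = "log_cutoff1 R w" and ?c2 = "log_cutoff2 R w"
  note b = log_cutoff_bounds[OF R w]
  have w2: "0 \<le> w\<^sup>2 - 1" "w\<^sup>2 - 1 \<le> w\<^sup>2" using w by simp_all
  have G0: "G \<ge> 0" using G(1) by linarith
  have "\<bar>\<phi> w * ((w\<^sup>2 - 1) * ?c2)\<bar> \<le> G * (w\<^sup>2 * (9 / (R * w\<^sup>2)))"
    unfolding abs_mult using w2 G b by (intro mult_mono) auto
  then have 1: "\<bar>\<phi> w * ((w\<^sup>2 - 1) * ?c2)\<bar> \<le> 9 * G / R" using w by (simp add: mult.commute)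
  have "\<bar>\<phi> w * (real n * (w * ?c1))\<bar> \<le> G * (real n * (w * (3 / (R * w))))"
    unfolding abs_mult using w G b by (intro mult_mono) auto
  then have 2: "\<bar>\<phi> w * (real n * (w * ?c1))\<bar> \<le> 3 * real n * G / R" using w by (simp add: mult_ac)
  have "\<bar>(w\<^sup>2 - 1) * (2 * \<phi>1 w * ?c1)\<bar> \<le> w\<^sup>2 * (2 * \<bar>\<phi>1 w\<bar> * (3 / (R * w)))"
    unfolding abs_mult using w2 b by (intro mult_mono) auto
  also have "\<dots> = 6 * \<bar>w * \<phi>1 w\<bar> / R" using w by (simp add: power2_eq_square abs_mult)
  also have "\<dots> \<le> 6 * G / R" using G R by (intro divide_right_mono) auto
  finally have 3: "\<bar>(w\<^sup>2 - 1) * (2 * \<phi>1 w * ?c1)\<bar> \<le> 6 * G / R" .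
  have "radial_op n (\<lambda>w. \<phi>1 w * log_cutoff R w + \<phi> w * log_cutoff1 R w)
      (\<lambda>w. \<phi>2 w * log_cutoff R w + 2 * \<phi>1 w * log_cutoff1 R w + \<phi> w * log_cutoff2 R w) w =
    log_cutoff R w * radial_op n \<phi>1 \<phi>2 w + \<phi> w * ((w\<^sup>2 - 1) * ?c2) + \<phi> w * (real n * (w * ?c1)) +
     (w\<^sup>2 - 1) * (2 * \<phi>1 w * ?c1)"
    by (simp add: radial_op_def algebra_simps)
  moreover have "(15 + 3 * real n) * G / R = 9 * G / R + 3 * real n * G / R + 6 * G / R"
    by (simp add: add_divide_distrib[symmetric] algebra_simps)
  ultimately show ?thesis using 1 2 3 by linarith
qed

context hyperbolic_radial
begin

text \<open>
  For the truncated test function \<open>\<psi> = \<phi> \<chi>\<^sub>R\<close>, the expectation \<open>f u = E \<psi>(q\<^sub>u)\<close> satisfies the differential inequality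
  \<open>f' \<ge> \<kappa> f - \<delta> C\<close> with \<open>\<delta> = O(1/R)\<close>.  It is integrated from \<open>0\<close> to \<open>t\<close>.
\<close>

lemma comparison_truncated:
  assumes d1: "\<And>w. w > 0 \<Longrightarrow> (\<phi> has_real_derivative \<phi>1 w) (at w)"
    and d2: "\<And>w. w > 0 \<Longrightarrow> (\<phi>1 has_real_derivative \<phi>2 w) (at w)"
    and c2: "continuous_on {0<..} \<phi>2"
    and sub: "\<And>w. w \<ge> 1 \<Longrightarrow> radial_op n \<phi>1 \<phi>2 w \<ge> \<kappa> * \<phi> w"
    and G: "\<And>w. w \<ge> 1 \<Longrightarrow> \<bar>\<phi> w\<bar> \<le> G w" "\<And>w. w \<ge> 1 \<Longrightarrow> \<bar>w * \<phi>1 w\<bar> \<le> G w"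
    and Gint: "\<And>u. 0 < u \<Longrightarrow> u \<le> t \<Longrightarrow> integrable M (\<lambda>\<omega>. G (q u \<omega>))"
    and GC: "\<And>u. 0 < u \<Longrightarrow> u \<le> t \<Longrightarrow> expectation (\<lambda>\<omega>. G (q u \<omega>)) \<le> C"
    and t: "t > 0" and R: "R \<ge> 1"
  shows "\<phi> 1 \<le> exp (- \<kappa> * t) * expectation (\<lambda>\<omega>. \<phi> (q t \<omega>) * log_cutoff R (q t \<omega>))
      + (15 + 3 * real n) / R * C * exp (\<bar>\<kappa>\<bar> * t) * t"
proof -
  define \<psi> where "\<psi> w = \<phi> w * log_cutoff R w" for w
  define \<psi>1 where "\<psi>1 w = \<phi>1 w * log_cutoff R w + \<phi> w * log_cutoff1 R w" for w
  define \<psi>2 where "\<psi>2 w = \<phi>2 w * log_cutoff R w + 2 * \<phi>1 w * log_cutoff1 R w + \<phi> w * log_cutoff2 R w" for w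
  define \<delta> where "\<delta> = (15 + 3 * real n) / R"
  have \<delta>0: "\<delta> \<ge> 0" using R by (simp add: \<delta>_def)
  have R0: "R > 0" using R by simp
  note cd = log_cutoff_derivatives[OF R0]
  have p1: "(\<psi> has_real_derivative \<psi>1 w) (at w)" if "w > 0" for w
    using DERIV_mult[OF d1[OF that] cd(1)[OF that]]
    by (simp add: \<psi>_def[abs_def] \<psi>1_def add.commute mult.commute)
  have p2: "(\<psi>1 has_real_derivative \<psi>2 w) (at w)" if "w > 0" for w
    using DERIV_add[OF DERIV_mult[OF d2[OF that] cd(1)[OF that]] DERIV_mult[OF d1[OF that] cd(2)[OF that]]]
    by (simp add: \<psi>1_def[abs_def] \<psi>2_def algebra_simps)
  have cont: "continuous_on {0<..} f" if "\<And>w. w > 0 \<Longrightarrow> (f has_real_derivative f1 w) (at w)" for f f1 :: "real \<Rightarrow> real"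
    by (rule DERIV_continuous_on[of _ _ f1]) (simp add: has_field_derivative_at_within that)
  have cc2: "continuous_on {0<..} (log_cutoff2 R)"
    unfolding log_cutoff2_def[abs_def] by (intro continuous_intros) (use R in auto)
  have c\<psi>2: "continuous_on {0<..} \<psi>2"
    unfolding \<psi>2_def[abs_def]
    by (intro continuous_intros c2 cc2 cont[of _ \<phi>1] cont[of _ \<phi>2] cont[of _ "log_cutoff1 R"] cont[of _ "log_cutoff2 R"] d1 d2 cd)
  have supp: "\<psi> w = 0 \<and> \<psi>1 w = 0 \<and> \<psi>2 w = 0" if "w \<ge> exp R" for w
  proof -
    have "w > 0" using that by (rule less_le_trans[OF exp_gt_zero])
    then have "ln w \<ge> R" using that by (simp add: ln_ge_iff)
    then have "max 0 (1 - ln w / R) = 0" using R0 by (simp add: field_simps max_def)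
    then show ?thesis
      by (simp add: \<psi>_def \<psi>1_def \<psi>2_def log_cutoff_def log_cutoff1_def log_cutoff2_def)
  qed
  have cL: "continuous_on {0<..} (radial_op n \<psi>1 \<psi>2)"
    unfolding radial_op_def[abs_def]
    by (intro continuous_intros c\<psi>2 cont[of _ \<psi>2] p2)
  have c\<psi>: "continuous_on {0<..} \<psi>" by (rule cont[OF p1])
  have bdd: "\<exists>K. \<forall>w\<ge>1. \<bar>f w\<bar> \<le> K" if f: "continuous_on {0<..} f" "\<And>w. w \<ge> exp R \<Longrightarrow> f w = 0" for f :: "real \<Rightarrow> real"
  proof -
    have "continuous_on {1..exp R} f" using f(1) by (rule continuous_on_subset) auto
    then have "bounded (f ` {1..exp R})" by (intro compact_imp_bounded compact_continuous_image) auto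
    then obtain K where "\<forall>y\<in>f ` {1..exp R}. norm y \<le> K"
      unfolding bounded_iff by blast
    then have K: "\<bar>f w\<bar> \<le> K" if "w \<in> {1..exp R}" for w
      using that by simp
    have "K \<ge> 0" using K[of 1] R by (smt (verit) atLeastAtMost_iff one_le_exp_iff)
    then have "\<bar>f w\<bar> \<le> K" if "w \<ge> 1" for w
      using K[of w] f(2)[of w] that by (cases "w \<le> exp R") auto
    then show ?thesis by blast
  qed
  have integ: "integrable M (\<lambda>\<omega>. f (q u \<omega>))"
    if u: "u > 0" and f: "continuous_on {0<..} f" "\<And>w. w \<ge> exp R \<Longrightarrow> f w = 0" for f :: "real \<Rightarrow> real" and u
  proof -
    obtain K where "\<And>w. w \<ge> 1 \<Longrightarrow> \<bar>f w\<bar> \<le> K" using bdd[OF f] by blast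
    then show ?thesis
      by (intro integrable_const_bound[of _ K] q_measurable f u AE_I2) (use q_ge_1[OF u] in auto)
  qed
  define f where "f u = expectation (\<lambda>\<omega>. \<psi> (q u \<omega>))" for u
  define f' where "f' u = expectation (\<lambda>\<omega>. radial_op n \<psi>1 \<psi>2 (q u \<omega>))" for u
  have df: "(f has_real_derivative f' u) (at u)" if "u > 0" for u
    unfolding f_def[abs_def] f'_def by (rule evolution[OF p1 p2 c\<psi>2 supp that])
  have f'_ge: "f' u \<ge> \<kappa> * f u - \<delta> * C" if u: "0 < u" "u \<le> t" for u
  proof -
    have "\<kappa> * f u - \<delta> * expectation (\<lambda>\<omega>. G (q u \<omega>)) =
        expectation (\<lambda>\<omega>. \<kappa> * \<psi> (q u \<omega>) - \<delta> * G (q u \<omega>))"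
      unfolding f_def using integ[OF u(1) c\<psi>] supp Gint[OF u] by simp
    also have "\<dots> \<le> f' u"
      unfolding f'_def
    proof (rule integral_mono)
      show "integrable M (\<lambda>\<omega>. \<kappa> * \<psi> (q u \<omega>) - \<delta> * G (q u \<omega>))"
        using integ[OF u(1) c\<psi>] supp Gint[OF u] by simp
      show "integrable M (\<lambda>\<omega>. radial_op n \<psi>1 \<psi>2 (q u \<omega>))"
        by (rule integ[OF u(1) cL]) (simp add: radial_op_def supp)
      fix \<omega> assume "\<omega> \<in> space M"
      then have w: "q u \<omega> \<ge> 1" by (rule q_ge_1[OF u(1)])
      have "\<kappa> * \<psi> (q u \<omega>) = log_cutoff R (q u \<omega>) * (\<kappa> * \<phi> (q u \<omega>))"
        by (simp add: \<psi>_def)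
      also have "\<dots> \<le> log_cutoff R (q u \<omega>) * radial_op n \<phi>1 \<phi>2 (q u \<omega>)"
        by (intro mult_left_mono sub w log_cutoff_bounds R)
      finally have "\<kappa> * \<psi> (q u \<omega>) \<le> log_cutoff R (q u \<omega>) * radial_op n \<phi>1 \<phi>2 (q u \<omega>)" .
      with radial_op_log_cutoff[of R "q u \<omega>" \<phi> "G (q u \<omega>)" \<phi>1 n \<phi>2, OF R w G[OF w]]
      show "\<kappa> * \<psi> (q u \<omega>) - \<delta> * G (q u \<omega>) \<le> radial_op n \<psi>1 \<psi>2 (q u \<omega>)"
        unfolding \<psi>1_def[abs_def] \<psi>2_def[abs_def] \<delta>_def by simp
    qed
    finally have "\<kappa> * f u - \<delta> * expectation (\<lambda>\<omega>. G (q u \<omega>)) \<le> f' u" .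
    moreover have "\<delta> * expectation (\<lambda>\<omega>. G (q u \<omega>)) \<le> \<delta> * C"
      by (rule mult_left_mono[OF GC[OF u] \<delta>0])
    ultimately show ?thesis by linarith
  qed
  have C0: "C \<ge> 0"
  proof -
    have "0 \<le> expectation (\<lambda>\<omega>. G (q t \<omega>))"
      by (intro Bochner_Integration.integral_nonneg_AE AE_I2 order_trans[OF abs_ge_zero G(1)] q_ge_1 t)
    then show ?thesis using GC[of t] t by simp
  qed
  define K where "K = \<delta> * C * exp (\<bar>\<kappa>\<bar> * t)"
  \<comment> \<open>The linear term makes \<open>h\<close> nondecreasing: its slope \<open>K\<close> absorbs the cutoff error on \<open>(0, t]\<close>.\<close>
  define h where "h u = exp (- \<kappa> * u) * f u + K * u" for u
  have mono: "h u \<le> h t" if u: "0 < u" "u \<le> t" for u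
  proof (rule DERIV_nonneg_imp_nondecreasing[OF u(2)])
    fix s assume s: "u \<le> s" "s \<le> t"
    then have s0: "s > 0" using u by simp
    have "(h has_real_derivative exp (- \<kappa> * s) * (f' s - \<kappa> * f s) + K) (at s)"
      unfolding h_def[abs_def]
      by (rule derivative_eq_intros df s0 refl)+ (simp add: algebra_simps)
    moreover have "0 \<le> exp (- \<kappa> * s) * (f' s - \<kappa> * f s) + K"
    proof -
      have "- \<kappa> * s \<le> \<bar>\<kappa>\<bar> * s" using s0 by (intro mult_right_mono) auto
      also have "\<dots> \<le> \<bar>\<kappa>\<bar> * t" using s by (intro mult_left_mono) auto
      finally have "exp (- \<kappa> * s) \<le> exp (\<bar>\<kappa>\<bar> * t)" by simp
      then have "exp (- \<kappa> * s) * (\<delta> * C) \<le> exp (\<bar>\<kappa>\<bar> * t) * (\<delta> * C)"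
        using \<delta>0 C0 by (intro mult_right_mono) auto
      then have "exp (- \<kappa> * s) * (\<delta> * C) \<le> K" by (simp add: K_def mult_ac)
      moreover have "exp (- \<kappa> * s) * (- (\<delta> * C)) \<le> exp (- \<kappa> * s) * (f' s - \<kappa> * f s)"
        using f'_ge[OF s0 s(2)] by (intro mult_left_mono) auto
      ultimately show ?thesis by simp
    qed
    ultimately show "\<exists>y. (h has_real_derivative y) (at s) \<and> 0 \<le> y" by blast
  qed
  have "(h \<longlongrightarrow> exp (- \<kappa> * 0) * \<psi> 1 + K * 0) (at_right 0)"
    unfolding h_def[abs_def]
  proof (intro tendsto_intros)
    obtain K where "\<And>w. w \<ge> 1 \<Longrightarrow> \<bar>\<psi> w\<bar> \<le> K" using bdd[OF c\<psi>] supp by blast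
    then have "bounded (\<psi> ` {1..})" unfolding bounded_iff by auto
    then show "(f \<longlongrightarrow> \<psi> 1) (at_right 0)"
      unfolding f_def[abs_def] by (rule initial[OF c\<psi>])
  qed
  moreover have "\<psi> 1 = \<phi> 1" by (simp add: \<psi>_def log_cutoff_def)
  ultimately have "(h \<longlongrightarrow> \<phi> 1) (at_right 0)" by simp
  moreover have "\<forall>\<^sub>F u in at_right 0. h u \<le> h t"
    using mono t by (auto simp: eventually_at_right_field intro!: exI[of _ t])
  ultimately have "\<phi> 1 \<le> h t"
    by (rule tendsto_upperbound) simp
  then show ?thesis
    by (simp add: h_def f_def \<psi>_def K_def \<delta>_def)
qed

text \<open>
  A subsolution \<open>\<phi>\<close>, that is \<open>L \<phi> \<ge> \<kappa> \<phi>\<close> for the radial operator \<open>L\<close>, grows in mean at least like \<open>exp (\<kappa> t)\<close>: let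
  \<open>R\<close> tend to infinity in the truncated statement.  Applied to \<open>- \<phi>\<close>, this is the upper bound for supersolutions.
  The dominating function \<open>G\<close> is a constant for bounded \<open>\<phi>\<close>, and a function with a known moment for unbounded
  \<open>\<phi>\<close>.
\<close>

lemma comparison:
  assumes d1: "\<And>w. w > 0 \<Longrightarrow> (\<phi> has_real_derivative \<phi>1 w) (at w)"
    and d2: "\<And>w. w > 0 \<Longrightarrow> (\<phi>1 has_real_derivative \<phi>2 w) (at w)"
    and c2: "continuous_on {0<..} \<phi>2"
    and sub: "\<And>w. w \<ge> 1 \<Longrightarrow> radial_op n \<phi>1 \<phi>2 w \<ge> \<kappa> * \<phi> w"
    and G: "\<And>w. w \<ge> 1 \<Longrightarrow> \<bar>\<phi> w\<bar> \<le> G w" "\<And>w. w \<ge> 1 \<Longrightarrow> \<bar>w * \<phi>1 w\<bar> \<le> G w"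
    and Gint: "\<And>u. 0 < u \<Longrightarrow> u \<le> t \<Longrightarrow> integrable M (\<lambda>\<omega>. G (q u \<omega>))"
    and GC: "\<And>u. 0 < u \<Longrightarrow> u \<le> t \<Longrightarrow> expectation (\<lambda>\<omega>. G (q u \<omega>)) \<le> C"
    and t: "t > 0"
  shows "integrable M (\<lambda>\<omega>. \<phi> (q t \<omega>))"
    and "exp (\<kappa> * t) * \<phi> 1 \<le> expectation (\<lambda>\<omega>. \<phi> (q t \<omega>))"
proof -
  have c\<phi>: "continuous_on {0<..} \<phi>"
    by (rule DERIV_continuous_on[of _ _ \<phi>1]) (simp add: has_field_derivative_at_within d1)
  have meas: "(\<lambda>\<omega>. \<phi> (q t \<omega>)) \<in> borel_measurable M"
    by (rule q_measurable[OF c\<phi> t])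
  have dom: "\<bar>\<phi> (q t \<omega>)\<bar> \<le> G (q t \<omega>)" if "\<omega> \<in> space M" for \<omega>
    by (rule G(1)[OF q_ge_1[OF t that]])
  have Gt: "integrable M (\<lambda>\<omega>. G (q t \<omega>))" using Gint t by simp
  show "integrable M (\<lambda>\<omega>. \<phi> (q t \<omega>))"
    by (rule Bochner_Integration.integrable_bound[OF Gt meas])
      (intro AE_I2, use dom in \<open>fastforce\<close>)
  define f where "f j = expectation (\<lambda>\<omega>. \<phi> (q t \<omega>) * log_cutoff (real (Suc j)) (q t \<omega>))" for j
  have lim: "f \<longlonglongrightarrow> expectation (\<lambda>\<omega>. \<phi> (q t \<omega>))"
    unfolding f_def[abs_def]
  proof (rule integral_dominated_convergence[OF meas _ Gt])
    fix j
    have "continuous_on {0<..} (log_cutoff (real (Suc j)))"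
      by (rule DERIV_continuous_on[of _ _ "log_cutoff1 (real (Suc j))"])
        (simp add: has_field_derivative_at_within log_cutoff_derivatives)
    then show "(\<lambda>\<omega>. \<phi> (q t \<omega>) * log_cutoff (real (Suc j)) (q t \<omega>)) \<in> borel_measurable M"
      by (intro borel_measurable_times meas q_measurable t)
    show "AE \<omega> in M. norm (\<phi> (q t \<omega>) * log_cutoff (real (Suc j)) (q t \<omega>)) \<le> G (q t \<omega>)"
    proof (rule AE_I2)
      fix \<omega> assume \<omega>: "\<omega> \<in> space M"
      have "\<bar>\<phi> (q t \<omega>)\<bar> * \<bar>log_cutoff (real (Suc j)) (q t \<omega>)\<bar> \<le> G (q t \<omega>) * 1"
        using dom[OF \<omega>] log_cutoff_bounds[OF _ q_ge_1[OF t \<omega>], of "real (Suc j)"]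
        by (intro mult_mono) auto
      then show "norm (\<phi> (q t \<omega>) * log_cutoff (real (Suc j)) (q t \<omega>)) \<le> G (q t \<omega>)"
        by (simp add: abs_mult)
    qed
    show "AE \<omega> in M. (\<lambda>j. \<phi> (q t \<omega>) * log_cutoff (real (Suc j)) (q t \<omega>)) \<longlonglongrightarrow> \<phi> (q t \<omega>)"
    proof (rule AE_I2)
      fix \<omega>
      have "(\<lambda>j. \<phi> (q t \<omega>) * max 0 (1 - ln (q t \<omega>) / real (Suc j)) ^ 3) \<longlonglongrightarrow> \<phi> (q t \<omega>) * max 0 (1 - 0) ^ 3"
        by (intro tendsto_intros LIMSEQ_Suc[OF lim_const_over_n])
      then show "(\<lambda>j. \<phi> (q t \<omega>) * log_cutoff (real (Suc j)) (q t \<omega>)) \<longlonglongrightarrow> \<phi> (q t \<omega>)"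
        by (simp add: log_cutoff_def)
    qed
  qed
  have "(\<lambda>j. exp (- \<kappa> * t) * f j + (15 + 3 * real n) / real (Suc j) * C * exp (\<bar>\<kappa>\<bar> * t) * t) \<longlonglongrightarrow>
      exp (- \<kappa> * t) * expectation (\<lambda>\<omega>. \<phi> (q t \<omega>)) + 0 * C * exp (\<bar>\<kappa>\<bar> * t) * t"
    by (intro tendsto_intros lim LIMSEQ_Suc[OF lim_const_over_n])
  then have "\<phi> 1 \<le> exp (- \<kappa> * t) * expectation (\<lambda>\<omega>. \<phi> (q t \<omega>)) + 0 * C * exp (\<bar>\<kappa>\<bar> * t) * t"
    by (rule LIMSEQ_le_const)
      (use comparison_truncated[OF d1 d2 c2 sub G Gint GC t] in \<open>auto simp: f_def\<close>)
  from mult_left_mono[OF this, of "exp (\<kappa> * t)"]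
  show "exp (\<kappa> * t) * \<phi> 1 \<le> expectation (\<lambda>\<omega>. \<phi> (q t \<omega>))"
    by (simp add: mult.assoc[symmetric] exp_add[symmetric])
qed

end

section \<open>Exponential moments of the distance\<close>

lemma has_derivative_powr_shift:
  fixes a s w :: real
  assumes "w + a > 0"
  shows "((\<lambda>w. (w + a) powr s) has_real_derivative s * (w + a) powr (s - 1)) (at w)"
  by (rule derivative_eq_intros refl | use assms in simp)+

lemma powr_first_second_derivative:
  fixes s w :: real
  assumes "w > 0"
  shows "((\<lambda>w. w powr s) has_real_derivative s * w powr (s - 1)) (at w)"
    and "((\<lambda>w. s * w powr (s - 1)) has_real_derivative s * (s - 1) * w powr (s - 2)) (at w)"
  using has_derivative_powr_shift[of w 0 s] DERIV_cmult[OF has_derivative_powr_shift[of w 0 "s - 1"], of s] assms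
  by (simp_all add: mult.assoc)

lemma continuous_on_powr_second_derivative:
  "continuous_on {0<..} (\<lambda>w::real. s * (s - 1) * w powr (s - 2))"
  by (intro continuous_intros) auto

lemma exp_arcosh_bounds:
  fixes w :: real
  assumes "w \<ge> 1"
  shows "w \<le> exp (arcosh w)" "exp (arcosh w) \<le> 2 * w"
proof -
  have a: "exp (arcosh w) = w + sqrt (w\<^sup>2 - 1)"
    using assms by (simp add: arcosh_real_def add_pos_nonneg)
  then show "w \<le> exp (arcosh w)" using assms by simp
  have "sqrt (w\<^sup>2 - 1) \<le> sqrt (w\<^sup>2)" by (rule real_sqrt_le_mono) simp
  then show "exp (arcosh w) \<le> 2 * w" using a assms by simp
qed

context hyperbolic_radial
begin

text \<open>
  The power \<open>y\<^sup>-\<^sup>s\<close> of the height is an eigenfunction of \<open>\<Delta>\<^sub>n\<close> with this eigenvalue, and for \<open>s\<close> near \<open>0\<close> its mean over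
  the rotations about the origin is comparable to the \<open>s\<close>-th power of \<open>cosh \<eta>\<close>.
\<close>

definition eigenvalue :: "real \<Rightarrow> real" where
  "eigenvalue s = s * (s + real n - 1)"

lemma radial_op_powr:
  assumes "w > 0"
  shows "radial_op n (\<lambda>w. s * w powr (s - 1)) (\<lambda>w. s * (s - 1) * w powr (s - 2)) w =
    eigenvalue s * w powr s - s * (s - 1) * w powr (s - 2)"
proof -
  have "w\<^sup>2 * w powr (s - 2) = w powr s" "w * w powr (s - 1) = w powr s"
    using assms by (simp_all add: powr_diff powr_numeral field_simps)
  moreover have "radial_op n (\<lambda>w. s * w powr (s - 1)) (\<lambda>w. s * (s - 1) * w powr (s - 2)) w =
    s * (s - 1) * (w\<^sup>2 * w powr (s - 2)) + real n * s * (w * w powr (s - 1)) - s * (s - 1) * w powr (s - 2)"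
    unfolding radial_op_def by (simp add: algebra_simps)
  ultimately show ?thesis by (simp add: eigenvalue_def algebra_simps)
qed

text \<open>
  Shifting \<open>w\<^sup>s\<close> to \<open>P = (w + 1)\<^sup>s\<close> gives a true supersolution: \<open>(w + 1) (L P - \<kappa> P) = - s (2 s - 2 + n) P\<close> with
  \<open>\<kappa> = eigenvalue s\<close>, and this is negative since \<open>n \<ge> 2\<close>.  It is unbounded, so it is composed with the increasing concave function
  \<open>x / (1 + \<epsilon> x)\<close>; the result is a bounded supersolution.  The bound is uniform in \<open>\<epsilon>\<close>, and monotone
  convergence gives the moment of \<open>P\<close> itself.
\<close>

lemma positive_moment_upper:
  assumes s: "0 < s" "s \<le> 1" and t: "t > 0"
  shows "integrable M (\<lambda>\<omega>. (q t \<omega> + 1) powr s)"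
    and "expectation (\<lambda>\<omega>. (q t \<omega> + 1) powr s) \<le> 2 powr s * exp (eigenvalue s * t)"
proof -
  define P where "P w = (w + 1) powr s" for w :: real
  define P1 where "P1 w = s * (w + 1) powr (s - 1)" for w :: real
  define P2 where "P2 w = s * ((s - 1) * (w + 1) powr (s - 2))" for w :: real
  have e0: "eigenvalue s \<ge> 0" using s n_ge_2 by (simp add: eigenvalue_def)
  have P: "P w > 0" if "w > 0" for w using that by (simp add: P_def)
  have dP: "(P has_real_derivative P1 w) (at w)" "(P1 has_real_derivative P2 w) (at w)" if "w > 0" for w
    using has_derivative_powr_shift[of w 1 s] DERIV_cmult[OF has_derivative_powr_shift[of w 1 "s - 1"], of s] that
    by (simp_all add: P_def[abs_def] P1_def[abs_def] P2_def)
  have P1P: "(w + 1) * P1 w = s * P w" "(w + 1)\<^sup>2 * P2 w = s * (s - 1) * P w" if "w > 0" for w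
    using that by (simp_all add: P_def P1_def P2_def powr_diff powr_numeral field_simps)
  have LP: "radial_op n P1 P2 w \<le> eigenvalue s * P w" if w: "w > 0" for w
  proof -
    have "(w + 1) * (eigenvalue s * P w - radial_op n P1 P2 w) = 
        (w + 1) * (eigenvalue s * P w) - (w - 1) * ((w + 1)\<^sup>2 * P2 w) - real n * w * ((w + 1) * P1 w)"
      by (simp add: radial_op_def power2_eq_square algebra_simps)
    also have "\<dots> = s * (2 * s - 2 + real n) * P w"
      unfolding P1P[OF w] by (simp add: eigenvalue_def algebra_simps)
    also have "\<dots> \<ge> 0" using s n_ge_2 P[OF w] by simp
    finally show ?thesis using w by (simp add: zero_le_mult_iff)
  qed
  have key: "integrable M (\<lambda>\<omega>. P (q t \<omega>) / (1 + \<epsilon> * P (q t \<omega>))) \<and>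
      expectation (\<lambda>\<omega>. P (q t \<omega>) / (1 + \<epsilon> * P (q t \<omega>))) \<le> 2 powr s * exp (eigenvalue s * t)"
    if \<epsilon>: "\<epsilon> > 0" for \<epsilon>
  proof -
    define Q where "Q w = 1 + \<epsilon> * P w" for w
    have Q: "Q w > 1" if "w > 0" for w using P[OF that] \<epsilon> by (simp add: Q_def)
    have PQ: "P w / Q w \<le> 1 / \<epsilon>" if "w > 0" for w
    proof -
      have "P w \<le> 1 / \<epsilon> * Q w" using \<epsilon> by (simp add: Q_def field_simps)
      then show ?thesis using Q[OF that] by (simp only: pos_divide_le_eq)
    qed
    define h where "h w = - (P w / Q w)" for w
    define h1 where "h1 w = - (P1 w / (Q w)\<^sup>2)" for w
    define h2 where "h2 w = - (P2 w / (Q w)\<^sup>2) + 2 * \<epsilon> * (P1 w)\<^sup>2 / (Q w) ^ 3" for w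
    have dQ: "(Q has_real_derivative \<epsilon> * P1 w) (at w)" if "w > 0" for w
      unfolding Q_def[abs_def] using DERIV_add[OF DERIV_const DERIV_cmult[OF dP(1)[OF that], of \<epsilon>], of 1] by simp
    have d1: "(h has_real_derivative h1 w) (at w)" if w: "w > 0" for w
    proof -
      have "(h has_real_derivative - ((P1 w * Q w - P w * (\<epsilon> * P1 w)) / (Q w * Q w))) (at w)"
        unfolding h_def[abs_def] by (intro DERIV_minus DERIV_divide dP dQ w) (use Q[OF w] in simp)
      moreover have "P1 w * Q w - P w * (\<epsilon> * P1 w) = P1 w" by (simp add: Q_def algebra_simps)
      ultimately show ?thesis by (simp add: h1_def power2_eq_square)
    qed
    have d2: "(h1 has_real_derivative h2 w) (at w)" if w: "w > 0" for w
    proof -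
      have d: "((\<lambda>w. - (P1 w / (Q w * Q w))) has_real_derivative
          - ((P2 w * (Q w * Q w) - P1 w * (\<epsilon> * P1 w * Q w + Q w * (\<epsilon> * P1 w))) / ((Q w * Q w) * (Q w * Q w)))) (at w)"
        by (rule derivative_eq_intros dP dQ w refl | use Q[OF w] in simp)+
      have alg: "- ((p2 * (Q w * Q w) - p1 * (\<epsilon> * p1 * Q w + Q w * (\<epsilon> * p1))) / ((Q w * Q w) * (Q w * Q w)))
          = - (p2 / (Q w)\<^sup>2) + 2 * \<epsilon> * p1\<^sup>2 / (Q w) ^ 3" for p1 p2
        using Q[OF w] by (simp add: field_simps power2_eq_square power3_eq_cube)
      have "((\<lambda>w. - (P1 w / (Q w * Q w))) has_real_derivative h2 w) (at w)"
        using d unfolding alg h2_def .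
      then show ?thesis by (simp add: h1_def[abs_def] power2_eq_square)
    qed
    have cont: "continuous_on {0<..} f" if "\<And>w. w > 0 \<Longrightarrow> (f has_real_derivative f1 w) (at w)" for f f1 :: "real \<Rightarrow> real"
      by (rule DERIV_continuous_on[of _ _ f1]) (simp add: has_field_derivative_at_within that)
    have "continuous_on {0<..} P2" unfolding P2_def[abs_def] by (intro continuous_intros) auto
    then have ch2: "continuous_on {0<..} h2"
      unfolding h2_def[abs_def]
      by (intro continuous_intros cont[OF dP(2)] cont[OF dQ]) (use Q in force)+
    have "integrable M (\<lambda>\<omega>. h (q t \<omega>))" "exp (eigenvalue s * t) * h 1 \<le> expectation (\<lambda>\<omega>. h (q t \<omega>))"
    proof (atomize(full), intro conjI)
      note c = comparison[OF d1 d2 ch2, of "eigenvalue s" "\<lambda>_. 1 / \<epsilon>" t "1 / \<epsilon>"]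
      have sub: "eigenvalue s * h w \<le> radial_op n h1 h2 w" if "w \<ge> 1" for w
      proof -
        have w: "w > 0" using that by simp
        have "radial_op n h1 h2 w = - (radial_op n P1 P2 w / (Q w)\<^sup>2) + (w\<^sup>2 - 1) * (2 * \<epsilon> * (P1 w)\<^sup>2 / (Q w) ^ 3)"
          by (simp add: radial_op_def h1_def h2_def add_divide_distrib diff_divide_distrib algebra_simps)
        \<comment> \<open>The sign of this term is the concavity of \<open>x / (1 + \<epsilon> x)\<close>.\<close>
        moreover have "(w\<^sup>2 - 1) * (2 * \<epsilon> * (P1 w)\<^sup>2 / (Q w) ^ 3) \<ge> 0"
          using that Q[OF w] \<epsilon> by (intro mult_nonneg_nonneg divide_nonneg_nonneg) auto
        moreover have "radial_op n P1 P2 w / (Q w)\<^sup>2 \<le> eigenvalue s * P w / (Q w)\<^sup>2"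
          using LP[OF w] Q[OF w] by (intro divide_right_mono) auto
        moreover have "eigenvalue s * P w / (Q w)\<^sup>2 \<le> eigenvalue s * P w / Q w"
          using Q[OF w] P[OF w] e0
          by (intro divide_left_mono) (auto simp: power2_eq_square)
        ultimately show ?thesis by (simp add: h_def)
      qed
      have b1: "\<bar>h w\<bar> \<le> 1 / \<epsilon>" if "w \<ge> 1" for w
        using PQ[of w] P[of w] Q[of w] that by (simp add: h_def)
      have b2: "\<bar>w * h1 w\<bar> \<le> 1 / \<epsilon>" if "w \<ge> 1" for w
      proof -
        have w: "w > 0" using that by simp
        have P10: "P1 w \<ge> 0" using s w by (simp add: P1_def)
        have "w * P1 w \<le> (w + 1) * P1 w" using P10 by (intro mult_right_mono) auto
        also have "\<dots> \<le> P w" unfolding P1P(1)[OF w] using s P[OF w] by simp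
        finally have "w * P1 w / (Q w)\<^sup>2 \<le> P w / Q w"
          using Q[OF w] P[OF w] w P10 by (intro frac_le) (auto simp: power2_eq_square)
        moreover have "\<bar>w * h1 w\<bar> = w * P1 w / (Q w)\<^sup>2"
          using w P10 by (simp add: h1_def abs_mult)
        ultimately show ?thesis using PQ[OF w] by linarith
      qed
      show "integrable M (\<lambda>\<omega>. h (q t \<omega>))"
        by (rule c(1)) (use sub b1 b2 t in \<open>auto simp: prob_space\<close>)
      show "exp (eigenvalue s * t) * h 1 \<le> expectation (\<lambda>\<omega>. h (q t \<omega>))"
        by (rule c(2)) (use sub b1 b2 t in \<open>auto simp: prob_space\<close>)
    qed
    moreover have "P 1 / Q 1 \<le> P 1"
      using P[of 1] Q[of 1] by (simp add: field_simps)
    then have "exp (eigenvalue s * t) * (P 1 / Q 1) \<le> exp (eigenvalue s * t) * P 1"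
      by (intro mult_left_mono) auto
    ultimately show ?thesis by (simp add: h_def[abs_def] Q_def[abs_def] P_def[of 1] mult.commute)
  qed
  define f where "f j \<omega> = P (q t \<omega>) / (1 + 1 / real (Suc j) * P (q t \<omega>))" for j \<omega>
  have fi: "integrable M (f j)" and fb: "expectation (f j) \<le> 2 powr s * exp (eigenvalue s * t)" for j
    using key[of "1 / real (Suc j)"] by (simp_all add: f_def[abs_def])
  have Pq: "P (q t \<omega>) > 0" if "\<omega> \<in> space M" for \<omega>
    using P q_ge_1[OF t that] by simp
  have mono: "f i \<omega> \<le> f j \<omega>" if "i \<le> j" "\<omega> \<in> space M" for i j \<omega>
    unfolding f_def using Pq[OF that(2)] that(1)
    by (intro divide_left_mono add_left_mono mult_right_mono mult_pos_pos add_pos_nonneg frac_le) auto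
  have inc: "incseq (\<lambda>j. expectation (f j))"
    by (rule monoI) (intro integral_mono fi mono)
  obtain L where L: "(\<lambda>j. expectation (f j)) \<longlonglongrightarrow> L"
    using incseq_convergent[OF inc, of "2 powr s * exp (eigenvalue s * t)"] fb by blast
  have PM: "(\<lambda>\<omega>. P (q t \<omega>)) \<in> borel_measurable M"
    by (rule q_measurable[OF _ t])
      (unfold P_def[abs_def], intro continuous_intros, auto)
  have lim: "AE \<omega> in M. (\<lambda>j. f j \<omega>) \<longlonglongrightarrow> P (q t \<omega>)"
  proof (rule AE_I2)
    fix \<omega>
    have "(\<lambda>j. P (q t \<omega>) / (1 + 1 / real (Suc j) * P (q t \<omega>))) \<longlonglongrightarrow> P (q t \<omega>) / (1 + 0 * P (q t \<omega>))"
      by (intro tendsto_intros LIMSEQ_Suc[OF lim_const_over_n]) simp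
    then show "(\<lambda>j. f j \<omega>) \<longlonglongrightarrow> P (q t \<omega>)" by (simp add: f_def)
  qed
  have mono': "AE \<omega> in M. mono (\<lambda>j. f j \<omega>)"
    by (intro AE_I2 monoI mono)
  show "integrable M (\<lambda>\<omega>. (q t \<omega> + 1) powr s)"
    using integrable_monotone_convergence[OF fi mono' lim L PM] by (simp add: P_def)
  have "expectation (\<lambda>\<omega>. P (q t \<omega>)) = L"
    by (rule integral_monotone_convergence[OF fi mono' lim L PM])
  moreover have "L \<le> 2 powr s * exp (eigenvalue s * t)"
    by (rule LIMSEQ_le_const2[OF L]) (use fb in blast)
  ultimately show "expectation (\<lambda>\<omega>. (q t \<omega> + 1) powr s) \<le> 2 powr s * exp (eigenvalue s * t)"
    by (simp add: P_def)
qed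

text \<open>
  For \<open>0 < s \<le> 1\<close> the error term \<open>- s (s - 1) w\<^sup>s\<^sup>-\<^sup>2\<close> is nonnegative, so \<open>w\<^sup>s\<close> is a subsolution; it is dominated by the
  moment just found.
\<close>

lemma positive_moment_lower:
  assumes s: "0 < s" "s \<le> 1" and t: "t > 0"
  shows "integrable M (\<lambda>\<omega>. q t \<omega> powr s)"
    and "exp (eigenvalue s * t) \<le> expectation (\<lambda>\<omega>. q t \<omega> powr s)"
proof -
  have e0: "eigenvalue s \<ge> 0" using s n_ge_2 by (simp add: eigenvalue_def)
  note c = comparison[OF powr_first_second_derivative[of _ s] continuous_on_powr_second_derivative,
      of "eigenvalue s" "\<lambda>w. (w + 1) powr s" t "2 powr s * exp (eigenvalue s * t)"]
  have sub: "eigenvalue s * w powr s \<le> radial_op n (\<lambda>w. s * w powr (s - 1)) (\<lambda>w. s * (s - 1) * w powr (s - 2)) w"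
    if "w \<ge> 1" for w
    using that s by (subst radial_op_powr) (auto simp: mult_le_0_iff)
  have b1: "\<bar>w powr s\<bar> \<le> (w + 1) powr s" if "w \<ge> 1" for w
    using that s by (simp add: powr_mono2)
  have b2: "\<bar>w * (s * w powr (s - 1))\<bar> \<le> (w + 1) powr s" if "w \<ge> 1" for w
  proof -
    have e: "w * (s * w powr (s - 1)) = s * w powr s"
      using that by (simp add: powr_diff)
    have "s * w powr s \<le> 1 * (w + 1) powr s"
      using that s by (intro mult_mono powr_mono2) auto
    then show ?thesis unfolding e using s by simp
  qed
  have C: "expectation (\<lambda>\<omega>. (q u \<omega> + 1) powr s) \<le> 2 powr s * exp (eigenvalue s * t)" if "0 < u" "u \<le> t" for u
  proof -
    have "2 powr s * exp (eigenvalue s * u) \<le> 2 powr s * exp (eigenvalue s * t)"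
      using e0 that by (intro mult_left_mono) (auto intro: mult_left_mono)
    then show ?thesis using positive_moment_upper(2)[OF s that(1)] by linarith
  qed
  show "integrable M (\<lambda>\<omega>. q t \<omega> powr s)"
    by (rule c(1)) (use sub b1 b2 C t positive_moment_upper(1)[OF s] in auto)
  have "exp (eigenvalue s * t) * 1 powr s \<le> expectation (\<lambda>\<omega>. q t \<omega> powr s)"
    by (rule c(2)) (use sub b1 b2 C t positive_moment_upper(1)[OF s] in auto)
  then show "exp (eigenvalue s * t) \<le> expectation (\<lambda>\<omega>. q t \<omega> powr s)" by simp
qed

lemma integrable_negative_moment:
  assumes "r \<ge> 0" and t: "t > 0"
  shows "integrable M (\<lambda>\<omega>. q t \<omega> powr (- r))"
proof (rule integrable_const_bound[of _ 1])
  show "AE \<omega> in M. norm (q t \<omega> powr - r) \<le> 1"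
  proof (rule AE_I2)
    fix \<omega> assume "\<omega> \<in> space M"
    then have "q t \<omega> powr - r \<le> q t \<omega> powr 0"
      using q_ge_1[OF t] assms by (intro powr_mono) auto
    then show "norm (q t \<omega> powr - r) \<le> 1" using q_ge_1[OF t \<open>\<omega> \<in> space M\<close>] by simp
  qed
  show "(\<lambda>\<omega>. q t \<omega> powr - r) \<in> borel_measurable M"
    by (rule q_measurable[OF _ t]) (intro continuous_intros, auto)
qed

text \<open>
  For negative exponents the error term has the other sign, and \<open>w\<^sup>-\<^sup>r\<close> is a bounded supersolution.
\<close>

lemma negative_moment_upper:
  assumes r: "0 < r" "r \<le> 1" and t: "t > 0"
  shows "expectation (\<lambda>\<omega>. q t \<omega> powr (- r)) \<le> exp (eigenvalue (- r) * t)"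
proof -
  let ?p1 = "\<lambda>w. - (- r * w powr (- r - 1))" and ?p2 = "\<lambda>w. - (- r * (- r - 1) * w powr (- r - 2))"
  note c = comparison(2)[OF DERIV_minus[OF powr_first_second_derivative(1)[of _ "- r"]]
      DERIV_minus[OF powr_first_second_derivative(2)[of _ "- r"]]
      continuous_on_minus[OF continuous_on_powr_second_derivative[of "- r"]],
      of "eigenvalue (- r)" "\<lambda>w. 1" t 1]
  have bnd: "w powr - r \<le> 1" if "w \<ge> 1" for w
    using powr_mono[of "- r" 0 w] that r by simp
  have sub: "eigenvalue (- r) * - (w powr - r) \<le> radial_op n ?p1 ?p2 w" if "w \<ge> 1" for w
  proof -
    have "radial_op n ?p1 ?p2 w = - radial_op n (\<lambda>w. - r * w powr (- r - 1)) (\<lambda>w. - r * (- r - 1) * w powr (- r - 2)) w"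
      by (simp add: radial_op_def algebra_simps)
    also have "\<dots> = - (eigenvalue (- r) * w powr - r) + r * (r + 1) * w powr (- r - 2)"
      using radial_op_powr[of w "- r"] that by (simp add: algebra_simps)
    finally show ?thesis using r by simp
  qed
  have b2: "\<bar>w * ?p1 w\<bar> \<le> 1" if "w \<ge> 1" for w
  proof -
    have e: "w * ?p1 w = r * w powr - r" using that by (simp add: powr_diff)
    show ?thesis unfolding e using bnd[OF that] r mult_mono[of r 1 "w powr - r" 1] by simp
  qed
  have "exp (eigenvalue (- r) * t) * - (1 powr - r) \<le> expectation (\<lambda>\<omega>. - (q t \<omega> powr - r))"
    by (rule c) (use sub b2 bnd t in \<open>auto simp: prob_space\<close>)
  then show ?thesis by simp
qed

text \<open>
  A subsolution is obtained by subtracting a multiple of a power that decays faster: the eigenvalue at \<open>p = - r - 1/2\<close>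
  is smaller than the one at \<open>- r\<close> by at least \<open>1/8\<close>, so the correction \<open>- c w\<^sup>p\<close> contributes at least
  \<open>(c / 8) w\<^sup>p\<close>.  The constant \<open>c = 8 r (r + 1)\<close> is chosen to compensate \<open>r (r + 1) w\<^sup>-\<^sup>r\<^sup>-\<^sup>2\<close>, and it
  is at most \<open>1/2\<close> when \<open>r \<le> 1/20\<close>.
\<close>

lemma negative_moment_lower:
  assumes r: "0 < r" "r \<le> 1 / 20" and t: "t > 0"
  shows "exp (eigenvalue (- r) * t) / 2 \<le> expectation (\<lambda>\<omega>. q t \<omega> powr (- r))"
proof -
  define c where "c = 8 * r * (r + 1)"
  define p where "p = - r - 1 / 2"
  have rr: "r * (r + 1) \<le> 1 / 20 * (21 / 20)" using r by (intro mult_mono) auto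
  have c: "0 \<le> c" "c \<le> 1 / 2" using r rr by (simp_all add: c_def)
  let ?f = "\<lambda>w. w powr - r - c * w powr p"
  let ?f1 = "\<lambda>w. - r * w powr (- r - 1) - c * (p * w powr (p - 1))"
  let ?f2 = "\<lambda>w. - r * (- r - 1) * w powr (- r - 2) - c * (p * (p - 1) * w powr (p - 2))"
  have d1: "(?f has_real_derivative ?f1 w) (at w)" and d2: "(?f1 has_real_derivative ?f2 w) (at w)" if "w > 0" for w
    by (intro DERIV_diff DERIV_cmult powr_first_second_derivative that)+
  have cf2: "continuous_on {0<..} ?f2"
    by (intro continuous_intros) auto
  have le1: "w powr a \<le> 1" if "w \<ge> 1" "a \<le> 0" for w a :: real
    using powr_mono[of a 0 w] that by simp
  have sub: "eigenvalue (- r) * ?f w \<le> radial_op n ?f1 ?f2 w" if w: "w \<ge> 1" for w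
  proof -
    have "radial_op n ?f1 ?f2 w = radial_op n (\<lambda>w. - r * w powr (- r - 1)) (\<lambda>w. - r * (- r - 1) * w powr (- r - 2)) w
       - c * radial_op n (\<lambda>w. p * w powr (p - 1)) (\<lambda>w. p * (p - 1) * w powr (p - 2)) w"
      by (simp add: radial_op_def algebra_simps)
    also have "\<dots> = eigenvalue (- r) * w powr - r - r * (r + 1) * w powr (- r - 2)
       - c * (eigenvalue p * w powr p - p * (p - 1) * w powr (p - 2))"
      using w by (subst (1 2) radial_op_powr) (auto simp: algebra_simps)
    finally have "radial_op n ?f1 ?f2 w - eigenvalue (- r) * ?f w =
       c * (eigenvalue (- r) - eigenvalue p) * w powr p - r * (r + 1) * w powr (- r - 2)
       + c * (p * (p - 1)) * w powr (p - 2)"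
      by (simp add: algebra_simps)
    moreover have "0 \<le> c * (p * (p - 1)) * w powr (p - 2)"
    proof -
      have "0 \<le> p * (p - 1)" using r by (intro mult_nonpos_nonpos) (auto simp: p_def)
      then show ?thesis using c by simp
    qed
    moreover have "r * (r + 1) * w powr (- r - 2) \<le> c * (eigenvalue (- r) - eigenvalue p) * w powr p"
    proof (rule mult_mono)
      have "eigenvalue (- r) - eigenvalue p = 1 / 2 * (real n - 1 - 2 * r - 1 / 2)"
        by (simp add: eigenvalue_def p_def field_simps)
      then have "1 / 8 \<le> eigenvalue (- r) - eigenvalue p" using n_ge_2 r by simp
      then have "c * (1 / 8) \<le> c * (eigenvalue (- r) - eigenvalue p)"
        using c by (intro mult_left_mono) auto
      then show "r * (r + 1) \<le> c * (eigenvalue (- r) - eigenvalue p)" by (simp add: c_def)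
      then show "0 \<le> c * (eigenvalue (- r) - eigenvalue p)" using r by (smt (verit) mult_nonneg_nonneg)
      show "w powr (- r - 2) \<le> w powr p" using w by (intro powr_mono) (auto simp: p_def)
    qed simp
    ultimately show ?thesis by linarith
  qed
  have b1: "\<bar>?f w\<bar> \<le> 2" if w: "w \<ge> 1" for w
  proof -
    have "w powr - r \<le> 1" "w powr p \<le> 1" using le1[OF w] r by (auto simp: p_def)
    moreover have "c * w powr p \<le> 1 * 1" using c calculation by (intro mult_mono) auto
    moreover have "0 \<le> w powr - r" "0 \<le> c * w powr p" using c by simp_all
    ultimately show ?thesis by linarith
  qed
  have b2: "\<bar>w * ?f1 w\<bar> \<le> 2" if w: "w \<ge> 1" for w
  proof -
    have e: "w * ?f1 w = - (r * w powr - r) + c * (- p) * w powr p"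
      using w by (simp add: powr_diff right_diff_distrib)
    have "w powr - r \<le> 1" "w powr p \<le> 1" using le1[OF w] r by (auto simp: p_def)
    then have "r * w powr - r \<le> 1 * 1" "c * (- p) * w powr p \<le> (1 * 1) * 1"
      using c r by (intro mult_mono; simp add: p_def)+
    moreover have "0 \<le> r * w powr - r" "0 \<le> c * (- p) * w powr p"
      using c r by (auto intro!: mult_nonneg_nonneg simp: p_def)
    ultimately show ?thesis unfolding e by linarith
  qed
  have "exp (eigenvalue (- r) * t) * ?f 1 \<le> expectation (\<lambda>\<omega>. ?f (q t \<omega>))"
    by (rule comparison(2)[OF d1 d2 cf2 sub b1 b2, where C = 2]) (use t in \<open>auto simp: prob_space\<close>)
  moreover have "exp (eigenvalue (- r) * t) / 2 \<le> exp (eigenvalue (- r) * t) * ?f 1"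
    using mult_left_mono[of "1 / 2" "?f 1" "exp (eigenvalue (- r) * t)"] c by simp
  moreover have "expectation (\<lambda>\<omega>. ?f (q t \<omega>)) \<le> expectation (\<lambda>\<omega>. q t \<omega> powr - r)"
  proof (rule integral_mono)
    have p0: "p \<le> 0" using r by (simp add: p_def)
    have "integrable M (\<lambda>\<omega>. q t \<omega> powr p)"
      using integrable_negative_moment[OF _ t, of "- p"] p0 by simp
    then show "integrable M (\<lambda>\<omega>. ?f (q t \<omega>))"
      using integrable_negative_moment[OF _ t, of r] r by simp
  qed (use integrable_negative_moment[OF _ t, of r] r c in simp_all)
  ultimately show ?thesis by linarith
qed

text \<open>
  The distance differs from \<open>ln q\<close> by at most \<open>ln 2\<close>, so its exponential moments are those of \<open>q\<close> up to a factor
  \<open>2\<^sup>|\<^sup>s\<^sup>|\<close>.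
\<close>

lemma distance_mgf:
  assumes s: "\<bar>s\<bar> \<le> 1 / 20" and t: "t > 0"
  shows "integrable M (\<lambda>\<omega>. exp (s * arcosh (q t \<omega>)))"
    and "exp (eigenvalue s * t) / 4 \<le> expectation (\<lambda>\<omega>. exp (s * arcosh (q t \<omega>)))"
    and "expectation (\<lambda>\<omega>. exp (s * arcosh (q t \<omega>))) \<le> 4 * exp (eigenvalue s * t)"
proof -
  let ?I = "\<lambda>\<omega>. exp (s * arcosh (q t \<omega>))"
  have Ipowr: "?I \<omega> = exp (arcosh (q t \<omega>)) powr s" for \<omega> by (simp add: powr_def)
  have meas: "?I \<in> borel_measurable M"
  proof -
    have "continuous_on {0<..} (\<lambda>w::real. max 1 w)" by (intro continuous_intros)
    then have "(\<lambda>\<omega>. max 1 (q t \<omega>)) \<in> borel_measurable M" by (rule q_measurable[OF _ t])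
    then have "(\<lambda>\<omega>. exp (s * ln (max 1 (q t \<omega>) + sqrt ((max 1 (q t \<omega>))\<^sup>2 - 1)))) \<in> borel_measurable M"
      by measurable
    then show ?thesis
      by (rule measurable_cong[THEN iffD1, rotated]) (use q_ge_1[OF t] in \<open>simp add: arcosh_real_def\<close>)
  qed
  have "integrable M ?I \<and> exp (eigenvalue s * t) / 4 \<le> expectation ?I \<and> expectation ?I \<le> 4 * exp (eigenvalue s * t)"
  proof (cases s "0 :: real" rule: linorder_cases)
    case equal
    then show ?thesis by (simp add: eigenvalue_def prob_space)
  next
    case greater
    then have s': "0 < s" "s \<le> 1" using s by auto
    note up = positive_moment_upper[OF s' t] and lo = positive_moment_lower[OF s' t]
    have two: "2 powr s \<le> 2" using powr_mono[of s 1 2] s' by simp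
    have I_le: "?I \<omega> \<le> 2 powr s * (q t \<omega> + 1) powr s" and I_ge: "q t \<omega> powr s \<le> ?I \<omega>" if "\<omega> \<in> space M" for \<omega>
    proof -
      note w = q_ge_1[OF t that]
      have "?I \<omega> \<le> (2 * (q t \<omega> + 1)) powr s"
        unfolding Ipowr using exp_arcosh_bounds[OF w] s' w by (intro powr_mono2) auto
      then show "?I \<omega> \<le> 2 powr s * (q t \<omega> + 1) powr s" by (simp only: powr_mult)
      show "q t \<omega> powr s \<le> ?I \<omega>"
        unfolding Ipowr using exp_arcosh_bounds[OF w] s' w by (intro powr_mono2) auto
    qed
    have int: "integrable M ?I"
      by (rule Bochner_Integration.integrable_bound[OF integrable_mult_right[OF up(1), of "2 powr s"] meas])
        (intro AE_I2, use I_le in simp)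
    have "expectation (\<lambda>\<omega>. q t \<omega> powr s) \<le> expectation ?I"
      by (intro integral_mono lo int I_ge)
    moreover have "exp (eigenvalue s * t) / 4 \<le> exp (eigenvalue s * t)" by simp
    ultimately have l: "exp (eigenvalue s * t) / 4 \<le> expectation ?I" using lo(2) by linarith
    have "expectation ?I \<le> expectation (\<lambda>\<omega>. 2 powr s * (q t \<omega> + 1) powr s)"
      by (intro integral_mono int I_le integrable_mult_right up(1))
    also have "\<dots> \<le> 2 powr s * (2 powr s * exp (eigenvalue s * t))" using up(2) by simp
    also have "\<dots> \<le> 2 * (2 * exp (eigenvalue s * t))"
      using two by (intro mult_mono) auto
    finally show ?thesis using int l by simp
  next
    case less
    define r where "r = - s"
    have r: "0 < r" "r \<le> 1 / 20" "r \<le> 1" and sr: "s = - r" using less s by (auto simp: r_def)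
    have two: "1 / 2 \<le> 2 powr s" using powr_mono[of "-1" s 2] s by (simp add: powr_minus)
    have I_le: "?I \<omega> \<le> q t \<omega> powr s" and I_ge: "2 powr s * q t \<omega> powr s \<le> ?I \<omega>" if "\<omega> \<in> space M" for \<omega>
    proof -
      note w = q_ge_1[OF t that]
      show "?I \<omega> \<le> q t \<omega> powr s"
        unfolding Ipowr using exp_arcosh_bounds[OF w] less w by (intro powr_mono2') auto
      have "(2 * q t \<omega>) powr s \<le> ?I \<omega>"
        unfolding Ipowr using exp_arcosh_bounds[OF w] less w by (intro powr_mono2') auto
      then show "2 powr s * q t \<omega> powr s \<le> ?I \<omega>" using w by (simp add: powr_mult)
    qed
    have iq: "integrable M (\<lambda>\<omega>. q t \<omega> powr s)"
      using integrable_negative_moment[OF _ t, of r] r by (simp add: sr)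
    have int: "integrable M ?I"
      by (rule Bochner_Integration.integrable_bound[OF iq meas])
        (intro AE_I2, use I_le in simp)
    have "expectation ?I \<le> expectation (\<lambda>\<omega>. q t \<omega> powr s)"
      by (intro integral_mono int I_le iq)
    also have "\<dots> \<le> exp (eigenvalue s * t)"
      using negative_moment_upper[OF r(1,3) t] by (simp add: sr)
    also have "\<dots> \<le> 4 * exp (eigenvalue s * t)" by simp
    finally have u: "expectation ?I \<le> 4 * exp (eigenvalue s * t)" .
    have "1 / 2 * (exp (eigenvalue s * t) / 2) \<le> 2 powr s * expectation (\<lambda>\<omega>. q t \<omega> powr s)"
      using negative_moment_lower[OF r(1,2) t] two by (intro mult_mono) (simp_all add: sr)
    also have "\<dots> = expectation (\<lambda>\<omega>. 2 powr s * q t \<omega> powr s)" by simp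
    also have "\<dots> \<le> expectation ?I"
      by (intro integral_mono int I_ge integrable_mult_right iq)
    finally show ?thesis using int u by simp
  qed
  then show "integrable M ?I" "exp (eigenvalue s * t) / 4 \<le> expectation ?I" "expectation ?I \<le> 4 * exp (eigenvalue s * t)"
    by blast+
qed

end

section \<open>A Gaussian limit of moment generating functions\<close>

text \<open>
  Markov's inequality under the law tilted by \<open>exp (\<theta> v X)\<close>; \<open>\<theta> = 0\<close> is the Chernoff bound.
\<close>

lemma exponential_tilting_tail_bound:
  fixes X :: "'w \<Rightarrow> real"
  assumes "prob_space M" and v: "v \<ge> 0"
    and int: "integrable M (\<lambda>\<omega>. exp ((\<theta> + \<tau>) * v * X \<omega>))"
    and A: "\<And>\<omega>. \<omega> \<in> A \<Longrightarrow> \<tau> * a \<le> \<tau> * X \<omega>"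
  shows "(\<integral>\<omega>. exp (\<theta> * v * X \<omega>) * indicator A \<omega> \<partial>M) \<le>
    exp (- \<tau> * v * a) * (\<integral>\<omega>. exp ((\<theta> + \<tau>) * v * X \<omega>) \<partial>M)"
proof -
  have "(\<integral>\<omega>. exp (\<theta> * v * X \<omega>) * indicator A \<omega> \<partial>M) \<le>
    (\<integral>\<omega>. exp (- \<tau> * v * a) * exp ((\<theta> + \<tau>) * v * X \<omega>) \<partial>M)"
  proof (rule integral_mono')
    fix \<omega>
    show "exp (\<theta> * v * X \<omega>) * indicator A \<omega> \<le> exp (- \<tau> * v * a) * exp ((\<theta> + \<tau>) * v * X \<omega>)"
    proof (cases "\<omega> \<in> A")
      case True
      have "v * (\<tau> * a) \<le> v * (\<tau> * X \<omega>)"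
        by (rule mult_left_mono[OF A[OF True] v])
      then show ?thesis
        using True by (simp add: exp_add[symmetric] algebra_simps)
    qed simp
  qed (use int in auto)
  then show ?thesis by simp
qed

text \<open>
  The Gaertner--Ellis theorem for the limit \<open>\<theta>\<^sup>2\<close>.  The upper bound is Chernoff's inequality at \<open>\<theta> = \<plusminus>m/2\<close>, for a
  closed set outside \<open>(-m, m)\<close>.  For the lower bound at \<open>x\<close>, the law is tilted by \<open>\<theta> = x/2\<close>: the tilted
  mass concentrates near \<open>x\<close>, since shifting \<open>\<theta>\<close> further by \<open>\<plusminus>\<delta>/2\<close> shows that the mass outside
  \<open>(x - \<delta>, x + \<delta>)\<close> is smaller by a factor \<open>exp (- v \<delta>\<^sup>2 / 4)\<close> up to constants.  Undoing the tilt on the small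
  interval leaves \<open>exp (- v x\<^sup>2 / 4)\<close> up to \<open>exp (v |\<theta>| \<delta>)\<close>.
\<close>

lemma gaussian_mgf_imp_large_deviation_principle:
  fixes X :: "real \<Rightarrow> 'w \<Rightarrow> real" and v :: "real \<Rightarrow> real"
  assumes M: "prob_space M"
    and meas: "\<And>t. t > 0 \<Longrightarrow> X t \<in> borel_measurable M"
    and v: "filterlim v at_top at_top"
    and mgf: "\<And>\<theta>. \<forall>\<^sub>F t in at_top. integrable M (\<lambda>\<omega>. exp (\<theta> * v t * X t \<omega>)) \<and>
        exp (v t * \<theta>\<^sup>2) / 4 \<le> (\<integral>\<omega>. exp (\<theta> * v t * X t \<omega>) \<partial>M) \<and>
        (\<integral>\<omega>. exp (\<theta> * v t * X t \<omega>) \<partial>M) \<le> 4 * exp (v t * \<theta>\<^sup>2)"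
  shows "large_deviation_principle M X v (\<lambda>x. ereal (x\<^sup>2 / 4))"
proof -
  interpret prob_space M by (rule M)
  have tpos: "\<forall>\<^sub>F t::real in at_top. t > 0" by (rule eventually_gt_at_top)
  have vbig: "\<forall>\<^sub>F t in at_top. v t > c" for c
    using v by (simp add: filterlim_at_top_dense)
  have v_inv: "((\<lambda>t. c / v t) \<longlongrightarrow> 0) at_top" for c :: real
    by (intro tendsto_divide_0[OF tendsto_const] filterlim_at_top_imp_at_infinity v)
  have rate: "rate_function (\<lambda>x. ereal (x\<^sup>2 / 4))"
    unfolding rate_function_def
  proof (intro conjI allI)
    fix x :: real
    have "((\<lambda>x. ereal (x\<^sup>2 / 4)) \<longlongrightarrow> ereal (x\<^sup>2 / 4)) (at x)"
      by (intro tendsto_intros) simp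
    from lim_imp_Liminf[OF _ this] show "ereal (x\<^sup>2 / 4) \<le> Liminf (at x) (\<lambda>x. ereal (x\<^sup>2 / 4))"
      by simp
  qed simp
  have upper: "Limsup at_top (\<lambda>t. ereal (1 / v t) * log_prob (measure M {\<omega>\<in>space M. X t \<omega> \<in> F}))
      \<le> - (INF x\<in>F. ereal (x\<^sup>2 / 4))" (is "?L \<le> _") if F: "closed F" for F :: "real set"
  proof -
    have key: "?L \<le> - ereal e" if e: "ereal e \<le> (INF x\<in>F. ereal (x\<^sup>2 / 4))" "e \<ge> 0" for e
    proof -
      define m where "m = 2 * sqrt e"
      have m: "m \<ge> 0" "m\<^sup>2 = 4 * e" using e(2) by (auto simp: m_def power_mult_distrib)
      have far: "m \<le> \<bar>x\<bar>" if "x \<in> F" for x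
      proof -
        have "ereal e \<le> ereal (x\<^sup>2 / 4)" using e(1) that by (auto simp: le_INF_iff)
        then have "m\<^sup>2 \<le> \<bar>x\<bar>\<^sup>2" using m by simp
        then show ?thesis by (rule power2_le_imp_le) simp
      qed
      have "\<forall>\<^sub>F t in at_top. ereal (1 / v t) * log_prob (measure M {\<omega>\<in>space M. X t \<omega> \<in> F})
        \<le> ereal (ln 8 / v t - e)"
        using tpos vbig[of 0] mgf[of "m / 2"] mgf[of "- m / 2"]
      proof eventually_elim
        case (elim t)
        have [measurable]: "X t \<in> borel_measurable M" using meas elim by simp
        define P where "P = prob {\<omega>\<in>space M. X t \<omega> \<in> F}"
        define U where "U = {\<omega>\<in>space M. m \<le> X t \<omega>}"
        define V where "V = {\<omega>\<in>space M. X t \<omega> \<le> - m}"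
        have [measurable]: "U \<in> sets M" "V \<in> sets M" unfolding U_def V_def by measurable
        have "prob U \<le> exp (- (m / 2) * v t * m) * (\<integral>\<omega>. exp (m / 2 * v t * X t \<omega>) \<partial>M)"
          using exponential_tilting_tail_bound[OF M, of "v t" 0 "m / 2" "X t" U m] elim m
          by (auto simp: U_def mult_left_mono)
        also have "\<dots> \<le> exp (- (m / 2) * v t * m) * (4 * exp (v t * (m / 2)\<^sup>2))"
          using elim by (intro mult_left_mono) auto
        finally have 1: "prob U \<le> exp (- (m / 2) * v t * m) * (4 * exp (v t * (m / 2)\<^sup>2))" .
        have "prob V \<le> exp (- (- m / 2) * v t * (- m)) * (\<integral>\<omega>. exp (- m / 2 * v t * X t \<omega>) \<partial>M)"
          using exponential_tilting_tail_bound[OF M, of "v t" 0 "- m / 2" "X t" V "- m"] elim m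
            mult_left_mono_neg[of "X t _" "- m" "- m / 2"]
          by (auto simp: V_def)
        also have "\<dots> \<le> exp (- (- m / 2) * v t * (- m)) * (4 * exp (v t * (- m / 2)\<^sup>2))"
          using elim by (intro mult_left_mono) auto
        finally have 2: "prob V \<le> exp (- (- m / 2) * v t * (- m)) * (4 * exp (v t * (- m / 2)\<^sup>2))" .
        have "P \<le> prob (U \<union> V)"
          unfolding P_def using far by (intro finite_measure_mono) (auto simp: U_def V_def abs_le_iff, fastforce)
        also have "\<dots> \<le> prob U + prob V" by (rule measure_Un_le) auto
        also have "\<dots> \<le> 8 * exp (v t * (- m\<^sup>2 / 4))"
          using add_mono[OF 1 2] by (simp add: exp_add[symmetric] power2_eq_square algebra_simps)
        also have "\<dots> = 8 * exp (- v t * e)" by (simp add: m)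
        finally have P: "P \<le> 8 * exp (- v t * e)" .
        show ?case
        proof (cases "P = 0")
          case True
          then show ?thesis using elim by (simp add: log_prob_def P_def)
        next
          case False
          then have "P > 0" by (simp add: P_def less_le)
          then have "ln P \<le> ln (8 * exp (- v t * e))" using P by (subst ln_le_cancel_iff) auto
          also have "\<dots> = ln 8 - v t * e" by (simp add: ln_mult)
          finally have "ln P / v t \<le> (ln 8 - v t * e) / v t" using elim by (intro divide_right_mono) auto
          also have "\<dots> = ln 8 / v t - e" using elim by (simp add: diff_divide_distrib)
          finally show ?thesis using False by (simp add: log_prob_def P_def)
        qed
      qed
      then have "?L \<le> Limsup at_top (\<lambda>t. ereal (ln 8 / v t - e))" by (rule Limsup_mono)
      moreover have "((\<lambda>t. ereal (ln 8 / v t - e)) \<longlongrightarrow> ereal (0 - e)) at_top"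
        by (intro tendsto_intros v_inv)
      then have "Limsup at_top (\<lambda>t. ereal (ln 8 / v t - e)) = ereal (0 - e)"
        by (intro lim_imp_Limsup) simp_all
      ultimately show ?thesis by simp
    qed
    have "(INF x\<in>F. ereal (x\<^sup>2 / 4)) \<le> - ?L"
    proof (rule dense_le)
      fix y assume "y < (INF x\<in>F. ereal (x\<^sup>2 / 4))"
      then obtain e where e: "y < ereal e" "ereal e < (INF x\<in>F. ereal (x\<^sup>2 / 4))"
        using ereal_dense2 by blast
      have "ereal (max 0 e) \<le> (INF x\<in>F. ereal (x\<^sup>2 / 4))"
      proof (rule INF_greatest)
        fix x assume "x \<in> F"
        then have "ereal e < ereal (x\<^sup>2 / 4)" using e(2) by (meson INF_lower less_le_trans)
        then show "ereal (max 0 e) \<le> ereal (x\<^sup>2 / 4)" by simp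
      qed
      from key[OF this] have "?L \<le> - ereal (max 0 e)" by simp
      then have "- (- ereal (max 0 e)) \<le> - ?L" by (subst ereal_minus_le_minus)
      then have "ereal (max 0 e) \<le> - ?L" by (simp only: ereal_uminus_uminus)
      moreover have "ereal e \<le> ereal (max 0 e)" by simp
      ultimately show "y \<le> - ?L" using less_imp_le[OF e(1)] by (blast intro: order_trans)
    qed
    then have "- (- ?L) \<le> - (INF x\<in>F. ereal (x\<^sup>2 / 4))" by (subst ereal_minus_le_minus)
    then show ?thesis by (simp only: ereal_uminus_uminus)
  qed
  have lower: "- (INF x\<in>G. ereal (x\<^sup>2 / 4)) \<le>
      Liminf at_top (\<lambda>t. ereal (1 / v t) * log_prob (measure M {\<omega>\<in>space M. X t \<omega> \<in> G}))"
    (is "_ \<le> ?L") if G: "open G" for G :: "real set"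
  proof -
    have "ereal (- x\<^sup>2 / 4) \<le> ?L" if x: "x \<in> G" for x
    proof (rule ereal_le_epsilon2)
      fix \<epsilon> :: real assume \<epsilon>: "\<epsilon> > 0"
      define \<theta> where "\<theta> = x / 2"
      obtain d where d: "d > 0" "\<And>y. \<bar>y - x\<bar> < d \<Longrightarrow> y \<in> G"
        using G x unfolding open_real by blast
      define \<delta> where "\<delta> = min d (\<epsilon> / (\<bar>\<theta>\<bar> + 1))"
      have \<delta>: "\<delta> > 0" "\<delta> \<le> d" using d \<epsilon> by (auto simp: \<delta>_def)
      have "\<bar>\<theta>\<bar> * \<delta> \<le> (\<bar>\<theta>\<bar> + 1) * (\<epsilon> / (\<bar>\<theta>\<bar> + 1))"
        using \<epsilon> d by (intro mult_mono) (auto simp: \<delta>_def)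
      then have \<theta>\<delta>: "\<bar>\<theta>\<bar> * \<delta> \<le> \<epsilon>" by (simp split: if_splits)
      have "\<forall>\<^sub>F t in at_top. ereal (- x\<^sup>2 / 4 - \<epsilon> - ln 8 / v t) \<le>
         ereal (1 / v t) * log_prob (measure M {\<omega>\<in>space M. X t \<omega> \<in> G})"
        using tpos vbig[of "4 * ln 64 / \<delta>\<^sup>2"] vbig[of 0] mgf[of \<theta>] mgf[of "\<theta> + \<delta> / 2"] mgf[of "\<theta> + - \<delta> / 2"]
      proof eventually_elim
        case (elim t)
        note v0 = elim(3)
        have [measurable]: "X t \<in> borel_measurable M" using meas elim by simp
        define P where "P = prob {\<omega>\<in>space M. X t \<omega> \<in> G}"
        define A where "A = {\<omega>\<in>space M. \<bar>X t \<omega> - x\<bar> < \<delta>}"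
        define U where "U = {\<omega>\<in>space M. x + \<delta> \<le> X t \<omega>}"
        define V where "V = {\<omega>\<in>space M. X t \<omega> \<le> x - \<delta>}"
        have [measurable]: "A \<in> sets M" "U \<in> sets M" "V \<in> sets M"
          unfolding A_def U_def V_def by measurable
        let ?Z = "\<lambda>\<omega>. exp (\<theta> * v t * X t \<omega>)"
        have int: "integrable M ?Z" using elim by simp
        have intI: "integrable M (\<lambda>\<omega>. ?Z \<omega> * indicator S \<omega>)" if "S \<in> sets M" for S
          using integrable_mult_indicator[OF that int] by (simp add: mult.commute)
        have "(\<integral>\<omega>. ?Z \<omega> \<partial>M) = (\<integral>\<omega>. ?Z \<omega> * indicator A \<omega> + ?Z \<omega> * indicator U \<omega> + ?Z \<omega> * indicator V \<omega> \<partial>M)"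
          using \<delta> by (intro Bochner_Integration.integral_cong)
            (auto simp: A_def U_def V_def indicator_def)
        also have "\<dots> = (\<integral>\<omega>. ?Z \<omega> * indicator A \<omega> \<partial>M) + (\<integral>\<omega>. ?Z \<omega> * indicator U \<omega> \<partial>M) + (\<integral>\<omega>. ?Z \<omega> * indicator V \<omega> \<partial>M)"
          by (simp add: intI)
        finally have split: "(\<integral>\<omega>. ?Z \<omega> \<partial>M) = (\<integral>\<omega>. ?Z \<omega> * indicator A \<omega> \<partial>M) + (\<integral>\<omega>. ?Z \<omega> * indicator U \<omega> \<partial>M) + (\<integral>\<omega>. ?Z \<omega> * indicator V \<omega> \<partial>M)" .
        have "(\<integral>\<omega>. ?Z \<omega> * indicator U \<omega> \<partial>M) \<le>
           exp (- (\<delta> / 2) * v t * (x + \<delta>)) * (\<integral>\<omega>. exp ((\<theta> + \<delta> / 2) * v t * X t \<omega>) \<partial>M)"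
          by (rule exponential_tilting_tail_bound[OF M]) (use elim \<delta> in \<open>auto simp: U_def mult_left_mono\<close>)
        also have "\<dots> \<le> exp (- (\<delta> / 2) * v t * (x + \<delta>)) * (4 * exp (v t * (\<theta> + \<delta> / 2)\<^sup>2))"
          using elim by (intro mult_left_mono) auto
        also have "\<dots> = 4 * exp (v t * (\<theta>\<^sup>2 - \<delta>\<^sup>2 / 4))"
          by (simp add: exp_add[symmetric] \<theta>_def power2_eq_square field_simps)
        finally have U: "(\<integral>\<omega>. ?Z \<omega> * indicator U \<omega> \<partial>M) \<le> 4 * exp (v t * (\<theta>\<^sup>2 - \<delta>\<^sup>2 / 4))" .
        have "(\<integral>\<omega>. ?Z \<omega> * indicator V \<omega> \<partial>M) \<le>
           exp (- (- \<delta> / 2) * v t * (x - \<delta>)) * (\<integral>\<omega>. exp ((\<theta> + - \<delta> / 2) * v t * X t \<omega>) \<partial>M)"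
          by (rule exponential_tilting_tail_bound[OF M])
            (use elim \<delta> mult_left_mono_neg[of "X t _" "x - \<delta>" "- \<delta> / 2"] in \<open>auto simp: V_def\<close>)
        also have "\<dots> \<le> exp (- (- \<delta> / 2) * v t * (x - \<delta>)) * (4 * exp (v t * (\<theta> + - \<delta> / 2)\<^sup>2))"
          using elim by (intro mult_left_mono) auto
        also have "\<dots> = 4 * exp (v t * (\<theta>\<^sup>2 - \<delta>\<^sup>2 / 4))"
          by (simp add: exp_add[symmetric] \<theta>_def power2_eq_square field_simps)
        finally have V: "(\<integral>\<omega>. ?Z \<omega> * indicator V \<omega> \<partial>M) \<le> 4 * exp (v t * (\<theta>\<^sup>2 - \<delta>\<^sup>2 / 4))" .
        have "ln 64 \<le> v t * \<delta>\<^sup>2 / 4" using elim(2) \<delta> by (simp add: field_simps)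
        then have "exp (ln 64) \<le> exp (v t * \<delta>\<^sup>2 / 4)" by (subst exp_le_cancel_iff)
        then have "64 * exp (v t * (\<theta>\<^sup>2 - \<delta>\<^sup>2 / 4)) \<le> exp (v t * \<delta>\<^sup>2 / 4) * exp (v t * (\<theta>\<^sup>2 - \<delta>\<^sup>2 / 4))"
          by (intro mult_right_mono) auto
        also have "\<dots> = exp (v t * \<theta>\<^sup>2)"
          by (simp add: exp_add[symmetric] algebra_simps)
        finally have small: "64 * exp (v t * (\<theta>\<^sup>2 - \<delta>\<^sup>2 / 4)) \<le> exp (v t * \<theta>\<^sup>2)" .
        have "exp (v t * \<theta>\<^sup>2) / 8 \<le> (\<integral>\<omega>. ?Z \<omega> * indicator A \<omega> \<partial>M)"
          using split U V small elim(4) by linarith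
        also have "\<dots> \<le> (\<integral>\<omega>. exp (v t * (\<theta> * x + \<bar>\<theta>\<bar> * \<delta>)) * indicator A \<omega> \<partial>M)"
        proof (rule integral_mono)
          fix \<omega>
          show "?Z \<omega> * indicator A \<omega> \<le> exp (v t * (\<theta> * x + \<bar>\<theta>\<bar> * \<delta>)) * indicator A \<omega>"
          proof (cases "\<omega> \<in> A")
            case True
            then have "\<bar>\<theta> * (X t \<omega> - x)\<bar> \<le> \<bar>\<theta>\<bar> * \<delta>"
              unfolding abs_mult by (intro mult_left_mono) (auto simp: A_def)
            then have "\<theta> * X t \<omega> \<le> \<theta> * x + \<bar>\<theta>\<bar> * \<delta>" by (simp add: algebra_simps abs_le_iff)
            from mult_left_mono[OF this, of "v t"] show ?thesis
              using v0 True by (simp add: mult_ac)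
          qed simp
        qed (auto intro!: intI integrable_real_mult_indicator simp: emeasure_eq_measure)
        also have "\<dots> = exp (v t * (\<theta> * x + \<bar>\<theta>\<bar> * \<delta>)) * prob A" by simp
        also have "prob A \<le> P"
        proof -
          have [measurable]: "G \<in> sets borel" using G by simp
          have "{\<omega> \<in> space M. X t \<omega> \<in> G} \<in> events" by measurable
          then show ?thesis
            unfolding P_def using d \<delta> by (intro finite_measure_mono) (auto simp: A_def)
        qed
        finally have "exp (v t * \<theta>\<^sup>2) / 8 \<le> exp (v t * (\<theta> * x + \<bar>\<theta>\<bar> * \<delta>)) * P"
          by simp
        then have "exp (- (v t * (\<theta> * x + \<bar>\<theta>\<bar> * \<delta>))) * (exp (v t * \<theta>\<^sup>2) / 8) \<le> P"
          by (simp add: exp_minus divide_simps mult.commute)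
        moreover have "exp (- (v t * (\<theta> * x + \<bar>\<theta>\<bar> * \<delta>))) * (exp (v t * \<theta>\<^sup>2) / 8) =
            exp (v t * (- x\<^sup>2 / 4 - \<bar>\<theta>\<bar> * \<delta>)) / 8"
          by (simp add: exp_add[symmetric] \<theta>_def power2_eq_square field_simps)
        ultimately have P: "exp (v t * (- x\<^sup>2 / 4 - \<bar>\<theta>\<bar> * \<delta>)) / 8 \<le> P" by simp
        have P0: "P > 0" by (rule less_le_trans[OF _ P]) simp
        have "v t * (- x\<^sup>2 / 4 - \<epsilon>) \<le> v t * (- x\<^sup>2 / 4 - \<bar>\<theta>\<bar> * \<delta>)"
          using \<theta>\<delta> v0 by (intro mult_left_mono) auto
        then have "v t * (- x\<^sup>2 / 4 - \<epsilon>) - ln 8 \<le> ln (exp (v t * (- x\<^sup>2 / 4 - \<bar>\<theta>\<bar> * \<delta>)) / 8)"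
          by (simp add: ln_div)
        also have "\<dots> \<le> ln P" using P P0 by (subst ln_le_cancel_iff) auto
        finally have "(v t * (- x\<^sup>2 / 4 - \<epsilon>) - ln 8) / v t \<le> ln P / v t"
          using v0 by (intro divide_right_mono) auto
        moreover have "(v t * (- x\<^sup>2 / 4 - \<epsilon>) - ln 8) / v t = - x\<^sup>2 / 4 - \<epsilon> - ln 8 / v t"
          using v0 by (simp add: diff_divide_distrib)
        ultimately show ?case using P0 by (simp add: log_prob_def P_def)
      qed
      then have "Liminf at_top (\<lambda>t. ereal (- x\<^sup>2 / 4 - \<epsilon> - ln 8 / v t)) \<le> ?L" by (rule Liminf_mono)
      moreover have "((\<lambda>t. ereal (- x\<^sup>2 / 4 - \<epsilon> - ln 8 / v t)) \<longlongrightarrow> ereal (- x\<^sup>2 / 4 - \<epsilon> - 0)) at_top"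
        by (intro tendsto_intros v_inv)
      then have "Liminf at_top (\<lambda>t. ereal (- x\<^sup>2 / 4 - \<epsilon> - ln 8 / v t)) = ereal (- x\<^sup>2 / 4 - \<epsilon> - 0)"
        by (intro lim_imp_Liminf) simp_all
      ultimately have "ereal (- x\<^sup>2 / 4 - \<epsilon>) \<le> ?L" by simp
      then show "ereal (- x\<^sup>2 / 4) \<le> ?L + ereal \<epsilon>"
        by (cases ?L) auto
    qed
    then have "- ?L \<le> (INF x\<in>G. ereal (x\<^sup>2 / 4))"
      by (intro INF_greatest) (subst ereal_uminus_le_reorder, simp)
    then show ?thesis by (subst ereal_uminus_le_reorder)
  qed
  show ?thesis
    unfolding large_deviation_principle_def
    using meas rate v upper lower by blast
qed

section \<open>The moderate deviation principle\<close>

theorem proposition3p3: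
  fixes n :: nat
    and M :: "'w measure"
    and k :: "real \<Rightarrow> real \<Rightarrow> real"
    and B :: "real \<Rightarrow> 'w \<Rightarrow> ('m::finite) hpoint"
    and D :: "real \<Rightarrow> 'w \<Rightarrow> real"
    and \<beta> :: real
  assumes "n \<ge> 2" and "CARD('m) = n - 1"
    and "heat_kernel (\<lambda>z (z' :: 'm hpoint) t. k (hdist z z') t)"
    and "hyperbolic_bm M (\<lambda>z z' t. k (hdist z z') t) B"
    and "D = radial_component B"
    and "0 < \<beta>" and "\<beta> < 1 / 2"
  shows "large_deviation_principle M
           (\<lambda>t \<omega>. t powr ((2 * \<beta> - 1) / 2) * ((D t \<omega> - (real n - 1) * t) / sqrt t))
           (\<lambda>t. t powr (1 - 2 * \<beta>))
           (\<lambda>x. ereal (x\<^sup>2 / 4))"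
proof -
  have n: "CARD('m) + 1 = n" using assms(1,2) by simp
  interpret hyperbolic_radial M n "\<lambda>t \<omega>. cosh_dist (B t \<omega>)"
    using hyperbolic_bm_imp_hyperbolic_radial[OF assms(3,4)] unfolding n .
  have D: "D t \<omega> = arcosh (cosh_dist (B t \<omega>))" for t \<omega>
    by (simp add: assms(5) radial_component_def hdist_horigin)
  have DM: "D t \<in> borel_measurable M" if "t > 0" for t
  proof -
    have [measurable]: "B t \<in> borel_measurable M"
      using assms(4) that unfolding hyperbolic_bm_def by simp
    have "(\<lambda>\<omega>. arcosh (cosh_dist (B t \<omega>))) \<in> borel_measurable M"
      unfolding arcosh_def by measurable
    then show ?thesis by (simp add: D[abs_def])
  qed
  define X where "X t \<omega> = t powr ((2 * \<beta> - 1) / 2) * ((D t \<omega> - (real n - 1) * t) / sqrt t)" for t \<omega>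
  define v where "v t = t powr (1 - 2 * \<beta>)" for t :: real
  have "large_deviation_principle M X v (\<lambda>x. ereal (x\<^sup>2 / 4))"
  proof (rule gaussian_mgf_imp_large_deviation_principle)
    show "prob_space M" by unfold_locales
    show "X t \<in> borel_measurable M" if "t > 0" for t
      using DM[OF that] unfolding X_def[abs_def] by measurable
    show "filterlim v at_top at_top"
      unfolding v_def[abs_def] using assms(7) by real_asymp
    fix \<theta> :: real
    have "((\<lambda>t. \<theta> * t powr - \<beta>) \<longlongrightarrow> \<theta> * 0) at_top"
      using assms(6) by (intro tendsto_intros tendsto_neg_powr filterlim_ident) auto
    then have "\<forall>\<^sub>F t in at_top. \<bar>\<theta> * t powr - \<beta>\<bar> < 1 / 20"
      by (auto simp: tendsto_iff dist_real_def dest: spec[of _ "1/20"])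
    with eventually_gt_at_top[of 0]
    show "\<forall>\<^sub>F t in at_top. integrable M (\<lambda>\<omega>. exp (\<theta> * v t * X t \<omega>)) \<and>
        exp (v t * \<theta>\<^sup>2) / 4 \<le> (\<integral>\<omega>. exp (\<theta> * v t * X t \<omega>) \<partial>M) \<and>
        (\<integral>\<omega>. exp (\<theta> * v t * X t \<omega>) \<partial>M) \<le> 4 * exp (v t * \<theta>\<^sup>2)"
    proof eventually_elim
      case (elim t)
      define s where "s = \<theta> * t powr - \<beta>"
      define E where "E = exp (- (s * (real n - 1) * t))"
      have pw: "v t * (t powr ((2 * \<beta> - 1) / 2) / sqrt t) = t powr - \<beta>"
      proof -
        have "v t * (t powr ((2 * \<beta> - 1) / 2) / sqrt t) = t powr (1 - 2 * \<beta> + (2 * \<beta> - 1) / 2 - 1 / 2)"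
          using elim by (simp only: v_def powr_diff powr_add powr_half_sqrt[symmetric] less_imp_le times_divide_eq_right)
        also have "1 - 2 * \<beta> + (2 * \<beta> - 1) / 2 - 1 / 2 = - \<beta>" by (simp add: field_simps)
        finally show ?thesis .
      qed
      have "\<theta> * v t * X t \<omega> = s * D t \<omega> - s * (real n - 1) * t" for \<omega>
      proof -
        have "\<theta> * v t * X t \<omega> = \<theta> * (v t * (t powr ((2 * \<beta> - 1) / 2) / sqrt t)) * (D t \<omega> - (real n - 1) * t)"
          by (simp add: X_def)
        then show ?thesis unfolding pw by (simp add: s_def algebra_simps)
      qed
      then have eX: "exp (\<theta> * v t * X t \<omega>) = E * exp (s * arcosh (cosh_dist (B t \<omega>)))" for \<omega>
        by (simp add: E_def D exp_add[symmetric])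
      have "s\<^sup>2 * t = v t * \<theta>\<^sup>2"
      proof -
        have "s\<^sup>2 * t = \<theta>\<^sup>2 * (t powr - \<beta> * t powr - \<beta> * t powr 1)"
          using elim by (simp add: s_def power2_eq_square mult_ac)
        also have "t powr - \<beta> * t powr - \<beta> * t powr 1 = v t"
          by (simp only: v_def powr_add[symmetric]) simp
        finally show ?thesis by simp
      qed
      then have eE: "E * exp (eigenvalue s * t) = exp (v t * \<theta>\<^sup>2)"
        by (simp add: E_def exp_add[symmetric] eigenvalue_def power2_eq_square algebra_simps)
      have E0: "E > 0" by (simp add: E_def)
      have "\<bar>s\<bar> \<le> 1 / 20" using elim by (simp add: s_def)
      note mgf = distance_mgf[OF this elim(1)]
      show ?case
        unfolding eX
        using mgf(1) mult_left_mono[OF mgf(2), of E] mult_left_mono[OF mgf(3), of E] E0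
        by (simp add: eE[symmetric] mult.left_commute)
    qed
  qed
  then show ?thesis by (simp only: X_def[abs_def] v_def[abs_def])
qed

end
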